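(* Let $k\geq 1$ and $R\geq 1$ be integers, and let $G,H$ be two graphs such that $\mathrm{sipco}(G)\leq k$, $\mathrm{sipco}(\langle H\rangle)\leq k$, and $G$ admits an honest, nicely rooted, $R$-bounded $H$-partition. Then there is a graph $F$ with $tw(F)\leq tw(H)$ such that $G$ admits a $(1,\,33\cdot R\cdot k^2)$-quasi-isometry to $F$.
   Context: All graphs are finite, connected and unweighted. $d_G$ is the shortest-path distance in $G$; a $(u,v)$-isometric path is a shortest $(u,v)$-path; $tw$ denotes treewidth. For $U\subseteq V(G)$, $B_G(U,\rho)$ is the set of vertices at distance at most $\rho$ from $U$ in $G$ (write $B_G(v,\rho)$ if $U=\{v\}$). These ball and distance notations are also used for possibly disconnected subgraphs of $G$. Quasi-isometry: for $M\ge 1$, $A\ge 0$, an $(M,A)$-quasi-isometry from $G$ to $F$ is a map $f:V(G)\to V(F)$ with $M^{-1}d_G(x,y)-A\le d_F(f(x),f(y))\le M d_G(x,y)+A$ for all $x,y\in V(G)$, and such that for every $z\in V(F)$ there is $x\in V(G)$ with $d_F(z,f(x))\le A$. Strong isometric path complexity: for $r\in V(G)$, an $r$-rooted isometric path is an isometric path having $r$ as an end-vertex. A path $P$ is covered by a set $\mathcal Q$ of paths if $V(P)\subseteq\bigcup_{Q\in\mathcal Q}V(Q)$. $\mathrm{ipco}(r,G)$ is the minimum integer $k$ such that every isometric path of $G$ can be covered by a set of $k$ many $r$-rooted isometric paths. $\mathrm{sipco}(G)$ is the minimum integer $k$ such that $\mathrm{ipco}(r,G)\le k$ for every $r\in V(G)$.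 For a graph class $\mathcal G$, $\mathrm{sipco}(\mathcal G)=\max\{\mathrm{sipco}(G):G\in\mathcal G\}$. $\langle H\rangle$ is the class of all graphs obtained from $H$ by subdividing edges (i.e. all subdivisions of $H$). $H$-partitions: an $H$-partition (graph-partition of $G$ over $H$) is a partition $(V_h:h\in V(H))$ of $V(G)$ such that for every edge $uv\in E(G)$ with $u\in V_g$, $v\in V_h$, either $g=h$ or $gh\in E(H)$. It is honest if every $V_h$ is non-empty and for every $gh\in E(H)$ there is an edge $uv\in E(G)$ with $u\in V_g$, $v\in V_h$. It is $R$-bounded if $d_G(u,v)\le R$ for all $u,v$ in the same $V_h$. Root $H$ at a node $s$. Let $\ell_h=d_H(s,h)$ and $L^i=\{h\in V(H):\ell_h=i\}$. Let $G^n$ be the subgraph of $G$ induced by $\bigcup_{i\le n}\bigcup_{h\in L^i}V_h$. For $h\ne s$, let $\delta^{\downarrow}_h$ be the set of vertices of $V_h$ adjacent to some vertex of $G^{\ell_h-1}$. The height of $h\neq s$ is $R_h=\max_{v\in V_h}d_G(\delta^{\downarrow}_h,v)$. $V_h$ is level if $V_h=B_{G-G^{\ell_h-1}}(\delta^{\downarrow}_h,R_h)$. A cluster of $H$ w.r.t. $s$ is a maximal set $S\subseteq V(H)\setminus\{s\}$ such that any two $u,v\in S$ satisfy $d_H(s,u)=d_H(s,v)=:j$ and lie in the same connected component of $H-B_H(s,j-1)$. An honest $R$-bounded $H$-partition is nicely rooted (w.r.t. the root $s$) if (a) every layer $L^j$ is an independent set of $H$; (b) there is a vertex $r\in V_s$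 with $V_s=B_G(r,R_s)$ for some integer $R_s\le R$, and $V_h$ is level for every $h\ne s$; (c) any two nodes of $H$ in the same cluster w.r.t. $s$ have the same height. *)

theory Defs
  imports "Graph_Theory.Graph_Theory" "HOL-Library.Extended_Nat" "HOL-Library.Disjoint_Sets"
begin

(* Finite simple graphs are the locale pair_graph: every edge uv is the pair of arcs (u,v), (v,u).
   The library notion of connectedness includes that the graph is non-empty. *)

definition conn_graph :: "'a pair_pre_digraph \<Rightarrow> bool" where
  "conn_graph G \<longleftrightarrow> pair_graph G \<and> Digraph_Component.connected (with_proj G)"

subsection \<open>Distances, balls, quasi-isometries\<close>

(* The distance is infinite iff the vertices lie in different components. *)
definition gdist :: "('a, 'b) pre_digraph \<Rightarrow> 'a \<Rightarrow> 'a \<Rightarrow> enat" where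
  "gdist G u v = (INF p\<in>{p. vwalk p G \<and> hd p = u \<and> last p = v}. enat (vwalk_length p))"

(* Only meaningful for u, v in the same component, since the_enat \<infinity> is unspecified. *)
definition ndist :: "('a, 'b) pre_digraph \<Rightarrow> 'a \<Rightarrow> 'a \<Rightarrow> nat" where
  "ndist G u v = the_enat (gdist G u v)"

definition set_dist :: "('a, 'b) pre_digraph \<Rightarrow> 'a set \<Rightarrow> 'a \<Rightarrow> enat" where
  "set_dist G U v = (INF u\<in>U. gdist G u v)"

definition graph_ball :: "('a, 'b) pre_digraph \<Rightarrow> 'a set \<Rightarrow> enat \<Rightarrow> 'a set" where
  "graph_ball G U \<rho> = {v \<in> verts G. set_dist G U v \<le> \<rho>}"

definition quasi_isometry ::
  "real \<Rightarrow> real \<Rightarrow> ('a, 'b) pre_digraph \<Rightarrow> ('c, 'd) pre_digraph \<Rightarrow> ('a \<Rightarrow> 'c) \<Rightarrow> bool" where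
  "quasi_isometry M A G F f \<longleftrightarrow>
     1 \<le> M \<and> 0 \<le> A \<and>
     f \<in> verts G \<rightarrow> verts F \<and>
     (\<forall>x\<in>verts G. \<forall>y\<in>verts G.
        inverse M * real (ndist G x y) - A \<le> real (ndist F (f x) (f y)) \<and>
        real (ndist F (f x) (f y)) \<le> M * real (ndist G x y) + A) \<and>
     (\<forall>z\<in>verts F. \<exists>x\<in>verts G. real (ndist F z (f x)) \<le> A)"

subsection \<open>Treewidth\<close>

(* The library's forest is not usable here: it forbids the closed walks u, v, u. *)
definition undirected_tree :: "'a pair_pre_digraph \<Rightarrow> bool" where
  "undirected_tree T \<longleftrightarrow>
     conn_graph T \<and> \<not> (\<exists>c. pre_digraph.cycle (with_proj T) c \<and> 3 \<le> length c)"

definition tree_decomposition ::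
  "'a pair_pre_digraph \<Rightarrow> 't pair_pre_digraph \<Rightarrow> ('t \<Rightarrow> 'a set) \<Rightarrow> bool" where
  "tree_decomposition G T B \<longleftrightarrow>
     undirected_tree T \<and>
     (\<Union>t\<in>pverts T. B t) = pverts G \<and>
     (\<forall>(u, v)\<in>parcs G. \<exists>t\<in>pverts T. u \<in> B t \<and> v \<in> B t) \<and>
     (\<forall>v\<in>pverts G. Digraph_Component.connected (with_proj T \<restriction> {t \<in> pverts T. v \<in> B t}))"

definition decomposition_width :: "'t pair_pre_digraph \<Rightarrow> ('t \<Rightarrow> 'a set) \<Rightarrow> nat" where
  "decomposition_width T B = Max ((\<lambda>t. card (B t)) ` pverts T) - 1"

(* Decomposition trees are finite, so nodes of type nat are no restriction. *)
definition treewidth :: "'a pair_pre_digraph \<Rightarrow> nat" where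
  "treewidth G = (LEAST w. \<exists>(T :: nat pair_pre_digraph) B.
     tree_decomposition G T B \<and> decomposition_width T B = w)"

subsection \<open>Strong isometric path complexity\<close>

definition isometric_path :: "('a, 'b) pre_digraph \<Rightarrow> 'a vwalk \<Rightarrow> bool" where
  "isometric_path G P \<longleftrightarrow> vpath P G \<and> enat (vwalk_length P) = gdist G (hd P) (last P)"

definition rooted_isometric_path :: "('a, 'b) pre_digraph \<Rightarrow> 'a \<Rightarrow> 'a vwalk \<Rightarrow> bool" where
  "rooted_isometric_path G r P \<longleftrightarrow> isometric_path G P \<and> (hd P = r \<or> last P = r)"

definition covered_by :: "'a vwalk \<Rightarrow> 'a vwalk set \<Rightarrow> bool" where
  "covered_by P Q \<longleftrightarrow> set P \<subseteq> (\<Union>q\<in>Q. set q)"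

(* Covering by at most k paths; the minimum is the same as for exactly k paths. *)
definition ipco :: "'a \<Rightarrow> ('a, 'b) pre_digraph \<Rightarrow> nat" where
  "ipco r G = (LEAST k. \<forall>P. isometric_path G P \<longrightarrow>
     (\<exists>Q. finite Q \<and> card Q \<le> k \<and> (\<forall>q\<in>Q. rooted_isometric_path G r q) \<and> covered_by P Q))"

definition sipco :: "('a, 'b) pre_digraph \<Rightarrow> nat" where
  "sipco G = (LEAST k. \<forall>r\<in>verts G. ipco r G \<le> k)"

(* The value is infinite if sipco is unbounded on the class. *)
definition sipco_class :: "'a pair_pre_digraph set \<Rightarrow> enat" where
  "sipco_class \<G> = (SUP G\<in>\<G>. enat (sipco (with_proj G)))"

(* Up to isomorphism: subdivision_pair adds new vertices of the same type, so an isomorphic copy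
   of H on natural numbers is subdivided. *)
definition subdivisions :: "'a pair_pre_digraph \<Rightarrow> nat pair_pre_digraph set" where
  "subdivisions H = {K. \<exists>H' :: nat pair_pre_digraph.
     digraph_iso (with_proj H) (with_proj H') \<and> subdivision_pair H' K}"

subsection \<open>Graph-partitions\<close>

definition graph_partition ::
  "'v pair_pre_digraph \<Rightarrow> 'h pair_pre_digraph \<Rightarrow> ('h \<Rightarrow> 'v set) \<Rightarrow> bool" where
  "graph_partition G H V \<longleftrightarrow>
     (\<Union>h\<in>pverts H. V h) = pverts G \<and> disjoint_family_on V (pverts H) \<and>
     (\<forall>(u, v)\<in>parcs G. \<forall>g\<in>pverts H. \<forall>h\<in>pverts H.
        u \<in> V g \<and> v \<in> V h \<longrightarrow> g = h \<or> (g, h) \<in> parcs H)"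

definition honest ::
  "'v pair_pre_digraph \<Rightarrow> 'h pair_pre_digraph \<Rightarrow> ('h \<Rightarrow> 'v set) \<Rightarrow> bool" where
  "honest G H V \<longleftrightarrow>
     (\<forall>h\<in>pverts H. V h \<noteq> {}) \<and>
     (\<forall>(g, h)\<in>parcs H. \<exists>u\<in>V g. \<exists>v\<in>V h. (u, v) \<in> parcs G)"

definition bounded_partition ::
  "nat \<Rightarrow> 'v pair_pre_digraph \<Rightarrow> 'h pair_pre_digraph \<Rightarrow> ('h \<Rightarrow> 'v set) \<Rightarrow> bool" where
  "bounded_partition R G H V \<longleftrightarrow>
     (\<forall>h\<in>pverts H. \<forall>u\<in>V h. \<forall>v\<in>V h. gdist (with_proj G) u v \<le> enat R)"

definition layer :: "'h pair_pre_digraph \<Rightarrow> 'h \<Rightarrow> nat \<Rightarrow> 'h set" where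
  "layer H s i = {h \<in> pverts H. gdist (with_proj H) s h = enat i}"

(* The vertex set of G^n. *)
definition lower_verts :: "'h pair_pre_digraph \<Rightarrow> ('h \<Rightarrow> 'v set) \<Rightarrow> 'h \<Rightarrow> nat \<Rightarrow> 'v set" where
  "lower_verts H V s n = (\<Union>i\<in>{..n}. \<Union>h\<in>layer H s i. V h)"

(* In the following notions h \<noteq> s, so that ndist H s h - 1 is not truncated. *)
definition down_boundary ::
  "'v pair_pre_digraph \<Rightarrow> 'h pair_pre_digraph \<Rightarrow> ('h \<Rightarrow> 'v set) \<Rightarrow> 'h \<Rightarrow> 'h \<Rightarrow> 'v set" where
  "down_boundary G H V s h =
     {v \<in> V h. \<exists>u\<in>lower_verts H V s (ndist (with_proj H) s h - 1). (v, u) \<in> parcs G}"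

definition height ::
  "'v pair_pre_digraph \<Rightarrow> 'h pair_pre_digraph \<Rightarrow> ('h \<Rightarrow> 'v set) \<Rightarrow> 'h \<Rightarrow> 'h \<Rightarrow> enat" where
  "height G H V s h = (SUP v\<in>V h. set_dist (with_proj G) (down_boundary G H V s h) v)"

definition level_part ::
  "'v pair_pre_digraph \<Rightarrow> 'h pair_pre_digraph \<Rightarrow> ('h \<Rightarrow> 'v set) \<Rightarrow> 'h \<Rightarrow> 'h \<Rightarrow> bool" where
  "level_part G H V s h \<longleftrightarrow>
     V h = graph_ball
       (with_proj G \<restriction> (pverts G - lower_verts H V s (ndist (with_proj H) s h - 1)))
       (down_boundary G H V s h) (height G H V s h)"

definition cluster_candidate :: "'h pair_pre_digraph \<Rightarrow> 'h \<Rightarrow> 'h set \<Rightarrow> bool" where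
  "cluster_candidate H s S \<longleftrightarrow>
     S \<subseteq> pverts H - {s} \<and>
     (\<forall>u\<in>S. \<forall>v\<in>S. \<exists>j. gdist (with_proj H) s u = enat j \<and> gdist (with_proj H) s v = enat j \<and>
        u \<rightarrow>\<^sup>*\<^bsub>with_proj H \<restriction> (pverts H - graph_ball (with_proj H) {s} (enat (j - 1)))\<^esub> v)"

definition cluster :: "'h pair_pre_digraph \<Rightarrow> 'h \<Rightarrow> 'h set \<Rightarrow> bool" where
  "cluster H s S \<longleftrightarrow>
     cluster_candidate H s S \<and> (\<forall>S'. cluster_candidate H s S' \<and> S \<subseteq> S' \<longrightarrow> S' = S)"

definition nicely_rooted ::
  "nat \<Rightarrow> 'v pair_pre_digraph \<Rightarrow> 'h pair_pre_digraph \<Rightarrow> ('h \<Rightarrow> 'v set) \<Rightarrow> 'h \<Rightarrow> bool" where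
  "nicely_rooted R G H V s \<longleftrightarrow>
     s \<in> pverts H \<and>
     (\<forall>j. \<forall>g\<in>layer H s j. \<forall>h\<in>layer H s j. (g, h) \<notin> parcs H) \<and>
     (\<exists>r\<in>V s. \<exists>R\<^sub>s\<le>R. V s = graph_ball (with_proj G) {r} (enat R\<^sub>s)) \<and>
     (\<forall>h\<in>pverts H - {s}. level_part G H V s h) \<and>
     (\<forall>S. cluster H s S \<longrightarrow> (\<forall>g\<in>S. \<forall>h\<in>S. height G H V s g = height G H V s h))"

end

theory Submission
  imports Defs
begin

text \<open>Write \<phi> for the distance in G from the centre r of the root part, and call an edge gh of H, with
  h one layer further from s than g, an up edge. The graph F is the subdivision of H in which such
  an edge gets length R_g + 1, where R_g is the height of V_g, and the quasi-isometry sends all of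
  V_h to the node h. Call D(h) the distance from s to h in F.

  Distances to the root agree. The total D(h) of the lengths along a vertical path from s to h does
  not depend on the path, because the nodes of a layer through which such paths can pass lie in a
  common cluster and have the same height. Assign to a vertex of V_h the sum of D(h) and its depth
  in the ball V_h. Along an edge of G this sum changes by at most one, and by exactly one along an
  edge between two parts: the lower end is at the top of its ball, since otherwise the upper end
  would belong to the same ball. So the sum is \<phi>, and \<phi> lies between D(h) and D(h) + R_h on V_h.

  Rooted paths control everything. An isometric path that is covered by k rooted isometric paths
  decomposes into at most k pieces with end points on a common rooted path, and along a rooted path
  the distance from the root is strictly monotone. Hence a function on pairs of vertices that
  satisfies the triangle inequality exceeds the distance by O(k) times its excess on comparable
  pairs and on edges (\<open>sipco_distortion\<close>). Applied in G to the distances of the images in F, this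
  gives one inequality with an error of 2Rk. Applied in F to the distances in G between chosen
  representatives of the parts, it gives the other one, provided that distances in G along a
  vertical path of H are at most O(Rk) larger than the difference of the values of D.

  This last bound (\<open>chain_part_dist\<close>) is the heart of the proof. Let C be a vertical path in H and
  descend in G from its upper end towards r, restarting on C as far down as the descent still meets
  C. Each restart costs R. It happens at a node of C from which a vertical path leads to s off C;
  call such a node free. There are at most k free nodes (\<open>card_free_chain_nodes_le\<close>): give the edges
  between C and its complement lengths for which all free nodes have the same large distance M from
  s, and all other edges length one. Then C is still isometric, while a path rooted at s contains
  at most one vertex at distance M. So at least as many rooted paths as free nodes are needed to
  cover C, and this subdivision of H has strong isometric path complexity at most k.

  Finally, subdividing does not increase the treewidth (\<open>treewidth_sub_le\<close>). If some bag has three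
  vertices, each new vertex is put into an additional leaf bag with the ends of the subdivided edge.
  Otherwise H is a tree, so the subdivision is a tree as well.\<close>

section \<open>Distances in finite connected graphs\<close>

lemma vwalk_nth_arc:
  assumes "vwalk p G" "Suc i < length p"
  shows "(p ! i, p ! Suc i) \<in> arcs_ends G"
  using assms
proof (induct p arbitrary: i rule: vwalk_arcs.induct)
  case (3 x y xs)
  show ?case
  proof (cases i)
    case 0
    then show ?thesis using 3(2) by (auto simp: vwalk_def)
  next
    case (Suc j)
    have "vwalk (y # xs) G" using 3(2) by (auto simp: vwalk_def)
    then show ?thesis using 3(1)[of j] 3(3) Suc by simp
  qed
qed auto

lemma vwalk_nth_relpow:
  assumes "vwalk p G" "i \<le> j" "j < length p"
  shows "(p ! i, p ! j) \<in> arcs_ends G ^^ (j - i)"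
  using assms(2,3)
proof (induct j rule: dec_induct)
  case (step n)
  then have "(p ! n, p ! Suc n) \<in> arcs_ends G"
    using vwalk_nth_arc[OF assms(1)] by simp
  with step have "(p ! i, p ! Suc n) \<in> arcs_ends G ^^ Suc (n - i)" by auto
  then show ?case using step by (simp add: Suc_diff_le)
qed simp

lemma relpow_vwalk:
  assumes "wf_digraph G" "(u, v) \<in> arcs_ends G ^^ n" "u \<in> verts G"
  shows "\<exists>p. vwalk p G \<and> hd p = u \<and> last p = v \<and> length p = Suc n"
  using assms(2,3)
proof (induct n arbitrary: u)
  case 0
  then show ?case by (intro exI[of _ "[u]"]) auto
next
  case (Suc n)
  obtain w where w: "(u, w) \<in> arcs_ends G" "(w, v) \<in> arcs_ends G ^^ n"
    using Suc(2) by (meson relpow_Suc_D2)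
  have "w \<in> verts G" using wf_digraph.adj_in_verts[OF assms(1) w(1)] by simp
  then obtain p where p: "vwalk p G" "hd p = w" "last p = v" "length p = Suc n"
    using Suc(1) w(2) by blast
  have "p \<noteq> []" using p by auto
  have "vwalk (u # p) G"
    using wf_digraph.vwalk_wf_digraph_consI[OF assms(1) p(1)] w p(2) by simp
  then show ?case using p \<open>p \<noteq> []\<close> by (intro exI[of _ "u # p"]) auto
qed

text \<open>The infimum of the walk lengths is attained, so distances can be computed with relation powers of
  the adjacency relation, which suit induction better than walks.\<close>

lemma gdist_le_iff:
  assumes "wf_digraph G" "u \<in> verts G"
  shows "gdist G u v \<le> enat n \<longleftrightarrow> (\<exists>m\<le>n. (u, v) \<in> arcs_ends G ^^ m)"
proof
  assume le: "gdist G u v \<le> enat n"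
  define W where "W = {p. vwalk p G \<and> hd p = u \<and> last p = v}"
  have "gdist G u v = Inf ((\<lambda>p. enat (vwalk_length p)) ` W)" by (simp add: gdist_def W_def)
  moreover have "W \<noteq> {}" using le calculation by (auto simp: top_enat_def)
  ultimately have "gdist G u v \<in> (\<lambda>p. enat (vwalk_length p)) ` W"
    by (metis wellorder_InfI ex_in_conv image_is_empty)
  then obtain p where p: "vwalk p G" "hd p = u" "last p = v" "length p - 1 \<le> n"
    using le by (auto simp: W_def)
  have "p \<noteq> []" using p(1) by auto
  have "(p ! 0, p ! (length p - 1)) \<in> arcs_ends G ^^ (length p - 1)"
    using vwalk_nth_relpow[OF p(1), of 0 "length p - 1"] \<open>p \<noteq> []\<close> by auto
  then show "\<exists>m\<le>n. (u, v) \<in> arcs_ends G ^^ m"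
    using p \<open>p \<noteq> []\<close> by (auto simp: hd_conv_nth last_conv_nth)
next
  assume "\<exists>m\<le>n. (u, v) \<in> arcs_ends G ^^ m"
  then obtain m where "m \<le> n" "(u, v) \<in> arcs_ends G ^^ m" by blast
  from relpow_vwalk[OF assms(1) this(2) assms(2)]
  obtain p where "vwalk p G" "hd p = u" "last p = v" "length p = Suc m" by blast
  then have "gdist G u v \<le> enat (vwalk_length p)"
    unfolding gdist_def by (intro INF_lower) auto
  with \<open>length p = Suc m\<close> \<open>m \<le> n\<close> show "gdist G u v \<le> enat n"
    by (metis diff_Suc_1 enat_ord_simps(1) order_trans vwalk_length_simp)
qed

lemma rtrancl_on_iff: "(u, v) \<in> rtrancl_on F R \<longleftrightarrow> u \<in> F \<and> (u, v) \<in> (R \<inter> F \<times> F)\<^sup>*"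
proof
  assume "(u, v) \<in> rtrancl_on F R"
  then show "u \<in> F \<and> (u, v) \<in> (R \<inter> F \<times> F)\<^sup>*"
    by induct (auto intro: converse_rtrancl_into_rtrancl)
next
  assume *: "u \<in> F \<and> (u, v) \<in> (R \<inter> F \<times> F)\<^sup>*"
  then have "(u, v) \<in> (R \<inter> F \<times> F)\<^sup>*" by simp
  then show "(u, v) \<in> rtrancl_on F R"
    using * by induct (auto intro: rtrancl_on_into_rtrancl_on)
qed

lemma connected_induced_iff:
  assumes "sym (parcs G)"
  shows "Digraph_Component.connected (with_proj G \<restriction> S) \<longleftrightarrow>
    S \<noteq> {} \<and> (\<forall>u\<in>S. \<forall>v\<in>S. (u, v) \<in> (parcs G \<inter> S \<times> S)\<^sup>*)"
proof -
  have ends: "arcs_ends (with_proj G \<restriction> S) = parcs G \<inter> S \<times> S" by (auto simp: arcs_ends_conv)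
  have "symcl (parcs G \<inter> S \<times> S) = parcs G \<inter> S \<times> S"
    using assms by (auto simp: symcl_def dest: symD)
  then show ?thesis
    unfolding connected_conv ends by (simp add: rtrancl_on_iff Int_assoc)
qed

lemma connected_pair_graph_iff:
  assumes "pair_graph G"
  shows "Digraph_Component.connected (with_proj G) \<longleftrightarrow>
    pverts G \<noteq> {} \<and> (\<forall>u\<in>pverts G. \<forall>v\<in>pverts G. (u, v) \<in> (parcs G)\<^sup>*)"
proof -
  interpret pair_graph G by fact
  have "symcl (parcs G) = parcs G" using arcs_symmetric by (auto simp: symcl_def)
  moreover have "parcs G \<inter> pverts G \<times> pverts G = parcs G" by (auto dest: in_arcsD1 in_arcsD2)
  ultimately show ?thesis unfolding connected_conv by (simp add: rtrancl_on_iff)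
qed

locale connected_graph =
  fixes G :: "'a pair_pre_digraph"
  assumes conn: "conn_graph G"
begin

sublocale pair_graph G using conn by (simp add: conn_graph_def)

abbreviation d :: "'a \<Rightarrow> 'a \<Rightarrow> nat" where "d \<equiv> ndist (with_proj G)"

lemma wf: "wf_digraph (with_proj G)"
  using pair_wf_digraph wf_digraph_wp_iff by blast

lemma sym_arc: "(u, v) \<in> parcs G \<Longrightarrow> (v, u) \<in> parcs G"
  by (rule arcs_symmetric)

lemma reach:
  assumes "u \<in> pverts G" "v \<in> pverts G"
  shows "(u, v) \<in> (parcs G)\<^sup>*"
proof -
  have "strongly_connected (with_proj G)"
    using wf_digraph.symmetric_connected_imp_strongly_connected[OF wf] sym_arcs conn
    by (simp add: conn_graph_def)
  then show ?thesis
    using assms reachable_rtranclI by (fastforce simp: strongly_connected_def)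
qed

lemma ex_vert: "pverts G \<noteq> {}"
  using conn unfolding conn_graph_def connected_conv by simp

lemma relpow_verts: "(u, v) \<in> parcs G ^^ n \<Longrightarrow> u \<in> pverts G \<Longrightarrow> v \<in> pverts G"
  by (induct n arbitrary: v) (auto dest: in_arcsD2)

lemma gdist_eq:
  assumes "u \<in> pverts G" "v \<in> pverts G"
  shows "gdist (with_proj G) u v = enat (d u v)"
proof -
  obtain n where "(u, v) \<in> parcs G ^^ n" using reach[OF assms] rtrancl_imp_relpow by blast
  then have "gdist (with_proj G) u v \<le> enat n"
    using gdist_le_iff[OF wf, of u v n] assms by auto
  then show ?thesis by (metis enat_ile ndist_def the_enat.simps)
qed

lemma d_le_iff:
  assumes "u \<in> pverts G" "v \<in> pverts G"
  shows "d u v \<le> n \<longleftrightarrow> (\<exists>m\<le>n. (u, v) \<in> parcs G ^^ m)"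
  using gdist_le_iff[OF wf, of u v n] assms gdist_eq[OF assms] by simp

lemma d_le_relpow: "(u, v) \<in> parcs G ^^ n \<Longrightarrow> u \<in> pverts G \<Longrightarrow> d u v \<le> n"
  using d_le_iff relpow_verts by blast

lemma d_relpow:
  assumes "u \<in> pverts G" "v \<in> pverts G"
  shows "(u, v) \<in> parcs G ^^ d u v"
proof -
  obtain m where "m \<le> d u v" "(u, v) \<in> parcs G ^^ m" using d_le_iff[OF assms] by blast
  moreover have "d u v \<le> m" using calculation d_le_relpow assms by blast
  ultimately show ?thesis by simp
qed

lemma d_self [simp]: "u \<in> pverts G \<Longrightarrow> d u u = 0"
  using d_le_relpow[of u u 0] by simp

lemma d_zeroD: "d u v = 0 \<Longrightarrow> u \<in> pverts G \<Longrightarrow> v \<in> pverts G \<Longrightarrow> u = v"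
  using d_relpow[of u v] by simp

lemma d_triangle:
  assumes "u \<in> pverts G" "v \<in> pverts G" "w \<in> pverts G"
  shows "d u w \<le> d u v + d v w"
  using d_relpow[OF assms(1,2)] d_relpow[OF assms(2,3)] assms
  by (intro d_le_relpow) (auto simp: relpow_add)

lemma d_arc: "(u, v) \<in> parcs G \<Longrightarrow> d u v \<le> 1"
  using d_le_relpow[of u v 1] in_arcsD1 by auto

lemma relpow_sym: "(u, v) \<in> parcs G ^^ n \<Longrightarrow> (v, u) \<in> parcs G ^^ n"
proof (induct n arbitrary: v)
  case (Suc n)
  then obtain w where "(u, w) \<in> parcs G ^^ n" "(w, v) \<in> parcs G" by auto
  then show ?case using Suc(1) sym_arc by (meson relpow_Suc_I2)
qed simp

lemma d_sym:
  assumes "u \<in> pverts G" "v \<in> pverts G"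
  shows "d u v = d v u"
  using assms d_le_relpow d_relpow relpow_sym by (meson antisym)

text \<open>The source of all lower bounds on distances below.\<close>

lemma lipschitz:
  fixes f :: "'a \<Rightarrow> int"
  assumes arc: "\<And>x y. (x, y) \<in> parcs G \<Longrightarrow> \<bar>f x - f y\<bar> \<le> 1"
    and "u \<in> pverts G" "v \<in> pverts G"
  shows "\<bar>f u - f v\<bar> \<le> int (d u v)"
proof -
  have "(u, v) \<in> parcs G ^^ n \<Longrightarrow> \<bar>f u - f v\<bar> \<le> int n" for n v
  proof (induct n arbitrary: v)
    case (Suc n)
    then obtain w where "\<bar>f u - f w\<bar> \<le> int n" "(w, v) \<in> parcs G" by auto
    then show ?case using arc[of w v] by linarith
  qed simp
  then show ?thesis using d_relpow assms by blast
qed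

lemma d_arc_diff:
  assumes "(x, y) \<in> parcs G" "r \<in> pverts G"
  shows "d r y \<le> d r x + 1"
  using d_triangle[of r x y] d_arc[OF assms(1)] assms in_arcsD1 in_arcsD2 by fastforce

text \<open>Ascending steps with respect to the root r. A geodesic from r consists of such steps, and
  the reflexive transitive closure says that one vertex lies on a geodesic from r to another.\<close>

definition up :: "'a \<Rightarrow> 'a rel" where
  "up r = {(x, y). (x, y) \<in> parcs G \<and> d r y = d r x + 1}"

lemma up_verts: "(x, y) \<in> (up r)\<^sup>* \<Longrightarrow> x \<in> pverts G \<longleftrightarrow> y \<in> pverts G"
  by (induct rule: rtrancl_induct) (auto simp: up_def dest: in_arcsD1 in_arcsD2)

text \<open>An ascending walk is a shortest path, since each step raises the distance from the root.\<close>

lemma up_dist: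
  assumes "(x, y) \<in> (up r)\<^sup>*" "x \<in> pverts G" "r \<in> pverts G"
  shows "d r y = d r x + d x y"
proof -
  have "d r y = d r x + n \<and> (x, y) \<in> parcs G ^^ n" if "(x, y) \<in> up r ^^ n" for n
    using that
  proof (induct n arbitrary: y)
    case (Suc n)
    then obtain z where z: "(x, z) \<in> up r ^^ n" "(z, y) \<in> up r" by auto
    then show ?case using Suc(1)[OF z(1)] by (auto simp: up_def)
  qed simp
  then obtain n where n: "d r y = d r x + n" "(x, y) \<in> parcs G ^^ n"
    using assms(1) rtrancl_imp_relpow by meson
  have "d x y \<le> n" using d_le_relpow n assms by blast
  moreover have "d r y \<le> d r x + d x y" using d_triangle assms up_verts by blast
  ultimately show ?thesis using n by simp
qed

lemma ex_lower:
  assumes "r \<in> pverts G" "x \<in> pverts G" "x \<noteq> r"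
  shows "\<exists>y. (y, x) \<in> up r"
proof -
  obtain n where n: "d r x = Suc n"
    using d_zeroD assms by (metis not0_implies_Suc)
  then obtain y where y: "(r, y) \<in> parcs G ^^ n" "(y, x) \<in> parcs G"
    using d_relpow assms by (metis relpow_Suc_E)
  then have "d r y \<le> n" using d_le_relpow assms by blast
  moreover have "d r x \<le> d r y + 1" using d_arc_diff y assms by blast
  ultimately show ?thesis using n y by (auto simp: up_def)
qed

lemma up_from_root:
  assumes "r \<in> pverts G" "x \<in> pverts G"
  shows "(r, x) \<in> (up r)\<^sup>*"
  using assms(2)
proof (induct "d r x" arbitrary: x rule: less_induct)
  case less
  show ?case
  proof (cases "x = r")
    case False
    then obtain y where "(y, x) \<in> up r" using ex_lower assms less by blast
    then show ?thesis using less(1)[of y] in_arcsD1 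
      by (auto simp: up_def intro: rtrancl_into_rtrancl)
  qed simp
qed

end

section \<open>Covering by rooted isometric paths\<close>

context connected_graph
begin

lemma vwalk_hd_last:
  assumes "vwalk p (with_proj G)"
  shows "hd p \<in> pverts G" "last p \<in> pverts G" "p \<noteq> []"
  using assms by (auto simp: vwalk_def)

lemma vwalk_nth_d:
  assumes "vwalk p (with_proj G)" "i \<le> j" "j < length p"
  shows "d (p ! i) (p ! j) \<le> j - i"
proof -
  have "(p ! i, p ! j) \<in> parcs G ^^ (j - i)" using vwalk_nth_relpow[OF assms] by simp
  moreover have "p ! i \<in> pverts G" using assms by (auto simp: vwalk_def)
  ultimately show ?thesis by (rule d_le_relpow)
qed

lemma shortest_walk_nth:
  assumes p: "vwalk p (with_proj G)" "length p = Suc (d (hd p) (last p))" and i: "i < length p"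
  shows "d (hd p) (p ! i) = i" "d (p ! i) (last p) = length p - 1 - i"
proof -
  have ne: "p \<noteq> []" using p vwalk_hd_last by blast
  have 1: "d (hd p) (p ! i) \<le> i"
    using vwalk_nth_d[OF p(1), of 0 i] i ne by (simp add: hd_conv_nth)
  have 2: "d (p ! i) (last p) \<le> length p - 1 - i"
    using vwalk_nth_d[OF p(1), of i "length p - 1"] i ne by (simp add: last_conv_nth)
  have "p ! i \<in> pverts G" using p i by (auto simp: vwalk_def)
  then have "d (hd p) (last p) \<le> d (hd p) (p ! i) + d (p ! i) (last p)"
    using d_triangle vwalk_hd_last p by blast
  then show "d (hd p) (p ! i) = i" "d (p ! i) (last p) = length p - 1 - i"
    using 1 2 p(2) i by auto
qed

lemma isometric_path_iff:
  "isometric_path (with_proj G) p \<longleftrightarrow>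
    vwalk p (with_proj G) \<and> length p = Suc (d (hd p) (last p))"
proof
  assume iso: "isometric_path (with_proj G) p"
  then have w: "vwalk p (with_proj G)" by (auto simp: isometric_path_def)
  have "enat (length p - 1) = enat (d (hd p) (last p))"
    using iso gdist_eq vwalk_hd_last[OF w] by (simp add: isometric_path_def)
  then show "vwalk p (with_proj G) \<and> length p = Suc (d (hd p) (last p))"
    using w vwalk_hd_last(3)[OF w] by (cases p) auto
next
  assume p: "vwalk p (with_proj G) \<and> length p = Suc (d (hd p) (last p))"
  then have "distinct p"
    using shortest_walk_nth(1) by (metis distinct_conv_nth)
  then show "isometric_path (with_proj G) p"
    using p vwalk_hd_last gdist_eq by (auto simp: isometric_path_def)
qed

lemma ex_isometric_path:
  assumes "u \<in> pverts G" "v \<in> pverts G"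
  shows "\<exists>p. isometric_path (with_proj G) p \<and> hd p = u \<and> last p = v"
proof -
  have "(u, v) \<in> arcs_ends (with_proj G) ^^ d u v" using d_relpow assms by simp
  from relpow_vwalk[OF wf this] assms show ?thesis
    unfolding isometric_path_iff by fastforce
qed

text \<open>Along an isometric path the distance from its end r changes by one in every step. All that is
  used of rooted paths is this comparability of their vertices.\<close>

lemma rooted_path_comparable:
  assumes q: "rooted_isometric_path (with_proj G) r q" and "x \<in> set q" "y \<in> set q"
  shows "(x, y) \<in> (up r)\<^sup>* \<or> (y, x) \<in> (up r)\<^sup>*"
proof -
  have w: "vwalk q (with_proj G)" "length q = Suc (d (hd q) (last q))"
    using q by (auto simp: rooted_isometric_path_def isometric_path_iff)
  have arc: "(q ! i, q ! Suc i) \<in> parcs G" if "Suc i < length q" for i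
    using vwalk_nth_arc[OF w(1) that] by simp
  have verts: "q ! i \<in> pverts G" if "i < length q" for i
    using w that by (auto simp: vwalk_def)
  have mono: "(q ! i, q ! j) \<in> (up r)\<^sup>* \<or> (q ! j, q ! i) \<in> (up r)\<^sup>*"
    if "i \<le> j" "j < length q" for i j
  proof -
    consider "hd q = r" | "last q = r" using q by (auto simp: rooted_isometric_path_def)
    then show ?thesis
    proof cases
      case 1
      have "(q ! i, q ! j) \<in> (up r)\<^sup>*" using that
      proof (induct j rule: dec_induct)
        case (step n)
        have "(q ! n, q ! Suc n) \<in> up r"
          using shortest_walk_nth(1)[OF w] 1 arc step by (simp add: up_def)
        with step show ?case by (auto intro: rtrancl_into_rtrancl)
      qed simp
      then show ?thesis by simp
    next
      case 2
      have r: "r \<in> pverts G" using vwalk_hd_last[OF w(1)] 2 by auto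
      have "(q ! j, q ! i) \<in> (up r)\<^sup>*" using that
      proof (induct j rule: dec_induct)
        case (step n)
        have "d r (q ! k) = length q - 1 - k" if "k < length q" for k
          using shortest_walk_nth(2)[OF w that] 2 d_sym[OF r verts[OF that]] by simp
        then have "(q ! Suc n, q ! n) \<in> up r"
          using arc[of n] sym_arc step by (simp add: up_def)
        with step show ?case by (auto intro: converse_rtrancl_into_rtrancl)
      qed simp
      then show ?thesis by simp
    qed
  qed
  obtain i j where "i < length q" "x = q ! i" "j < length q" "y = q ! j"
    using assms(2,3) by (metis in_set_conv_nth)
  then show ?thesis using mono[of i j] mono[of j i] by (cases "i \<le> j") auto
qed

text \<open>The two minima in the definition of strong isometric path complexity are attained: every
  vertex lies on some rooted isometric path, so finitely many paths cover the whole graph.\<close>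

lemma sipco_cover:
  assumes "sipco (with_proj G) \<le> k" "r \<in> pverts G" "isometric_path (with_proj G) P"
  shows "\<exists>Q. finite Q \<and> card Q \<le> k \<and> (\<forall>q\<in>Q. rooted_isometric_path (with_proj G) r q) \<and>
    covered_by P Q"
proof -
  define cov where "cov r n \<longleftrightarrow> (\<forall>P. isometric_path (with_proj G) P \<longrightarrow>
     (\<exists>Q. finite Q \<and> card Q \<le> n \<and> (\<forall>q\<in>Q. rooted_isometric_path (with_proj G) r q) \<and>
       covered_by P Q))" for r n
  have ipco: "ipco r (with_proj G) = (LEAST n. cov r n)" for r
    by (simp add: ipco_def cov_def)
  have "cov r (card (pverts G))" if r: "r \<in> pverts G" for r
    unfolding cov_def
  proof (intro allI impI)
    fix P assume P: "isometric_path (with_proj G) P"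
    obtain f where f: "\<And>v. v \<in> pverts G \<Longrightarrow>
        isometric_path (with_proj G) (f v) \<and> hd (f v) = r \<and> last (f v) = v"
      using ex_isometric_path[OF r] by metis
    have "v \<in> set (f v)" if "v \<in> pverts G" for v
      using f[OF that] vwalk_hd_last(3) isometric_path_iff by (metis last_in_set)
    moreover have "set P \<subseteq> pverts G" using P by (auto simp: isometric_path_def vpath_def vwalk_def)
    ultimately have "covered_by P (f ` pverts G)" by (auto simp: covered_by_def)
    then show "\<exists>Q. finite Q \<and> card Q \<le> card (pverts G) \<and>
        (\<forall>q\<in>Q. rooted_isometric_path (with_proj G) r q) \<and> covered_by P Q"
      using f by (intro exI[of _ "f ` pverts G"])
        (auto simp: rooted_isometric_path_def card_image_le pair_finite_verts)
  qed
  then have least: "cov r (ipco r (with_proj G))" if "r \<in> pverts G" for r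
    unfolding ipco using that LeastI[of "cov r"] by blast
  have "\<forall>r\<in>verts (with_proj G). ipco r (with_proj G) \<le> Max ((\<lambda>r. ipco r (with_proj G)) ` pverts G)"
    using pair_finite_verts by simp
  then have "\<forall>r\<in>verts (with_proj G). ipco r (with_proj G) \<le> sipco (with_proj G)"
    unfolding sipco_def by (rule LeastI)
  then have "ipco r (with_proj G) \<le> k" using assms by fastforce
  then show ?thesis using least[OF assms(2)] assms(3) unfolding cov_def by (meson order_trans)
qed

text \<open>Follow the covering path through the current vertex up to its last vertex on the walk, then take
  one step. The covering path just used is never met again, so there are at most n such rounds.
  Each costs an excess of a on the path and of b on the step.\<close>

lemma covered_walk_length:
  fixes \<delta> :: "'a \<Rightarrow> 'a \<Rightarrow> nat"
  assumes tri: "\<And>x y z. x \<in> pverts G \<Longrightarrow> y \<in> pverts G \<Longrightarrow> z \<in> pverts G \<Longrightarrow>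
      \<delta> x z \<le> \<delta> x y + \<delta> y z"
    and arc: "\<And>x y. (x, y) \<in> parcs G \<Longrightarrow> \<delta> x y \<le> 1 + b"
    and "finite Q" "card Q \<le> n" "vwalk p (with_proj G)" "covered_by p Q"
    and "\<And>q x y. q \<in> Q \<Longrightarrow> x \<in> set q \<Longrightarrow> y \<in> set q \<Longrightarrow> x \<in> pverts G \<Longrightarrow> y \<in> pverts G \<Longrightarrow>
      \<delta> x y \<le> d x y + a"
  shows "\<delta> (hd p) (last p) \<le> length p - 1 + n * (a + b)"
  using assms(3-)
proof (induct n arbitrary: Q p)
  case 0
  then show ?case using vwalk_hd_last(3)[of p] by (auto simp: covered_by_def)
next
  case (Suc n)
  have p: "p \<noteq> []" using Suc vwalk_hd_last(3) by blast
  then obtain q where q: "q \<in> Q" "hd p \<in> set q" using Suc(5) hd_in_set[OF p] unfolding covered_by_def by blast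
  define I where "I = {i. i < length p \<and> p ! i \<in> set q}"
  have I: "finite I" "0 \<in> I" using p q by (auto simp: I_def hd_conv_nth)
  define i where "i = Max I"
  \<comment> \<open>The walk leaves q for good after position i.\<close>
  have "i \<in> I" using Max_in[OF I(1)] I(2) by (auto simp only: i_def)
  then have i: "i < length p" "p ! i \<in> set q" by (auto simp: I_def)
  have later: "p ! j \<notin> set q" if "i < j" "j < length p" for j
    using Max_ge[OF I(1), of j] that unfolding i_def[symmetric] by (auto simp: I_def)
  have v: "p ! j \<in> pverts G" if "j < length p" for j using Suc(4) that by (auto simp: vwalk_def)
  have "d (hd p) (p ! i) \<le> i" using vwalk_nth_d[OF Suc(4), of 0 i] i p by (simp add: hd_conv_nth)
  then have first: "\<delta> (hd p) (p ! i) \<le> i + a"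
    using Suc(6)[OF q(1) q(2) i(2)] vwalk_hd_last[OF Suc(4)] v[OF i(1)] by linarith
  show ?case
  proof (cases "Suc i = length p")
    case True
    then have "\<delta> (hd p) (last p) \<le> length p - 1 + a"
      using first p by (metis diff_Suc_1 last_conv_nth)
    then show ?thesis by simp
  next
    case False
    define p' where "p' = drop (Suc i) p"
    have len: "Suc i < length p" using False i by simp
    have p': "p' \<noteq> []" "hd p' = p ! Suc i" "last p' = last p" "length p' = length p - Suc i"
      using len by (auto simp: p'_def hd_drop_conv_nth)
    have w: "vwalk p' (with_proj G)"
      using vwalkI_append_r[of p' "take (Suc i) p"] p' Suc(4) by (simp add: p'_def)
    have "covered_by p' (Q - {q})"
      unfolding covered_by_def
    proof
      fix x assume "x \<in> set p'"
      then obtain j where "j < length p'" "x = p' ! j" by (metis in_set_conv_nth)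
      then have j: "x = p ! (Suc i + j)" "Suc i + j < length p" using len by (auto simp: p'_def)
      then have "x \<in> set p" by simp
      moreover have "x \<notin> set q" using later[of "Suc i + j"] j by simp
      ultimately show "x \<in> (\<Union>q\<in>Q - {q}. set q)" using Suc(5) by (auto simp: covered_by_def)
    qed
    then have IH: "\<delta> (hd p') (last p') \<le> length p' - 1 + n * (a + b)"
      using Suc(2,3,6) q w by (intro Suc(1)) auto
    have "\<delta> (p ! i) (p ! Suc i) \<le> 1 + b"
      using arc vwalk_nth_arc[OF Suc(4) len] by simp
    moreover have "\<delta> (hd p) (last p) \<le> \<delta> (hd p) (p ! i) + \<delta> (p ! i) (last p)"
      "\<delta> (p ! i) (last p) \<le> \<delta> (p ! i) (p ! Suc i) + \<delta> (p ! Suc i) (last p)"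
      using tri v[OF i(1)] v[OF len] vwalk_hd_last[OF Suc(4)] by blast+
    moreover have "\<delta> (p ! Suc i) (last p) \<le> (length p - Suc i - 1) + n * (a + b)"
      using IH p' by simp
    moreover have "i + 1 + (length p - Suc i - 1) = length p - 1" using len by simp
    ultimately show ?thesis using first by (simp add: algebra_simps)
  qed
qed

text \<open>A pseudo-metric that exceeds the distance by at most a between comparable vertices, and by at most
  b across edges, exceeds it everywhere by at most k times a + b.\<close>

lemma sipco_distortion:
  fixes \<delta> :: "'a \<Rightarrow> 'a \<Rightarrow> nat"
  assumes "sipco (with_proj G) \<le> k" "r \<in> pverts G"
    and tri: "\<And>x y z. x \<in> pverts G \<Longrightarrow> y \<in> pverts G \<Longrightarrow> z \<in> pverts G \<Longrightarrow>
      \<delta> x z \<le> \<delta> x y + \<delta> y z"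
    and sym: "\<And>x y. x \<in> pverts G \<Longrightarrow> y \<in> pverts G \<Longrightarrow> \<delta> x y = \<delta> y x"
    and arc: "\<And>x y. (x, y) \<in> parcs G \<Longrightarrow> \<delta> x y \<le> 1 + b"
    and up: "\<And>x y. (x, y) \<in> (up r)\<^sup>* \<Longrightarrow> x \<in> pverts G \<Longrightarrow> y \<in> pverts G \<Longrightarrow> \<delta> x y \<le> d x y + a"
    and uv: "u \<in> pverts G" "v \<in> pverts G"
  shows "\<delta> u v \<le> d u v + k * (a + b)"
proof -
  obtain P where P: "isometric_path (with_proj G) P" "hd P = u" "last P = v"
    using ex_isometric_path[OF uv] by blast
  then obtain Q where Q: "finite Q" "card Q \<le> k" "covered_by P Q"
    "\<And>q. q \<in> Q \<Longrightarrow> rooted_isometric_path (with_proj G) r q"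
    using sipco_cover[OF assms(1,2) P(1)] by blast
  have "\<delta> x y \<le> d x y + a"
    if "q \<in> Q" "x \<in> set q" "y \<in> set q" "x \<in> pverts G" "y \<in> pverts G" for q x y
    using rooted_path_comparable[OF Q(4)[OF that(1)] that(2,3)] up[of x y] up[of y x] that(4,5)
      sym[OF that(4,5)] d_sym[OF that(4,5)] by auto
  then have "\<delta> (hd P) (last P) \<le> length P - 1 + k * (a + b)"
    using P Q by (intro covered_walk_length[OF tri arc, where Q = Q]) (auto simp: isometric_path_iff)
  then show ?thesis using P by (simp add: isometric_path_iff)
qed

end

section \<open>Weighted subdivisions of layered graphs\<close>

text \<open>Every edge joins two consecutive layers and is therefore an ascending step in one of its
  directions. The relation \<open>up s\<close> orients each edge away from s.\<close>

locale layered_graph = connected_graph H for H :: "'h pair_pre_digraph" +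
  fixes s :: 'h
  assumes root: "s \<in> pverts H"
    and layer_indep: "(g, h) \<in> parcs H \<Longrightarrow> d s g \<noteq> d s h"
begin

lemma up_or_down: "(g, h) \<in> parcs H \<Longrightarrow> (g, h) \<in> up s \<or> (h, g) \<in> up s"
  using d_arc_diff[OF _ root, of g h] d_arc_diff[OF sym_arc root, of g h] layer_indep[of g h] sym_arc
  by (fastforce simp: up_def)

lemma upD:
  assumes "(g, h) \<in> up s"
  shows "(g, h) \<in> parcs H" "g \<in> pverts H" "h \<in> pverts H" "g \<noteq> h" "d s h = Suc (d s g)"
    "(h, g) \<notin> up s"
  using assms in_arcsD1 in_arcsD2 by (auto simp: up_def)

lemma finite_up: "finite (up s)"
  by (rule finite_subset[OF _ pair_finite_arcs]) (auto simp: up_def)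

end

text \<open>Subdivisions need a supply of new vertices of the same type. The code of (h, h, 0) stands for
  the node h, and the code of (g, h, i) with i > 0 for the i-th interior vertex of the edge gh,
  counted from its lower end g.\<close>

locale coded_layered_graph = layered_graph H s for H :: "'h pair_pre_digraph" and s +
  fixes code :: "'h \<times> 'h \<times> nat \<Rightarrow> nat"
  assumes code_inj: "inj_on code (pverts H \<times> pverts H \<times> UNIV)"
begin

definition node_pt :: "'h \<Rightarrow> nat" where "node_pt h = code (h, h, 0)"

definition decode :: "nat \<Rightarrow> 'h \<times> 'h \<times> nat" where
  "decode = inv_into (pverts H \<times> pverts H \<times> UNIV) code"

text \<open>The vertex at distance i from g on the subdivided up edge gh, ends included.\<close>

definition edge_pt :: "('h \<Rightarrow> 'h \<Rightarrow> nat) \<Rightarrow> 'h \<Rightarrow> 'h \<Rightarrow> nat \<Rightarrow> nat" where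
  "edge_pt w g h i = (if i = 0 then node_pt g else if i = w g h then node_pt h else code (g, h, i))"

definition weighted_subdivision :: "('h \<Rightarrow> 'h \<Rightarrow> nat) \<Rightarrow> nat pair_pre_digraph" where
  "weighted_subdivision w = \<lparr>pverts = node_pt ` pverts H \<union> {edge_pt w g h i |g h i. (g, h) \<in> up s \<and> i \<le> w g h},
    parcs = (\<Union>(g, h)\<in>up s. \<Union>i<w g h.
      {(edge_pt w g h i, edge_pt w g h (Suc i)), (edge_pt w g h (Suc i), edge_pt w g h i)})\<rparr>"

definition positive_weight :: "('h \<Rightarrow> 'h \<Rightarrow> nat) \<Rightarrow> bool" where
  "positive_weight w \<longleftrightarrow> (\<forall>(g, h)\<in>up s. 1 \<le> w g h)"

lemma decode_code [simp]: "g \<in> pverts H \<Longrightarrow> h \<in> pverts H \<Longrightarrow> decode (code (g, h, i)) = (g, h, i)"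
  unfolding decode_def by (rule inv_into_f_f[OF code_inj]) auto

lemma decode_nd [simp]: "h \<in> pverts H \<Longrightarrow> decode (node_pt h) = (h, h, 0)"
  by (simp add: node_pt_def)

lemma nd_eq_iff [simp]: "g \<in> pverts H \<Longrightarrow> h \<in> pverts H \<Longrightarrow> node_pt g = node_pt h \<longleftrightarrow> g = h"
  by (metis decode_nd fst_conv)

lemma decode_pt:
  assumes "(g, h) \<in> up s"
  shows "decode (edge_pt w g h i) =
    (if i = 0 then (g, g, 0) else if i = w g h then (h, h, 0) else (g, h, i))"
  using upD[OF assms] by (simp add: edge_pt_def)

lemma pt_0 [simp]: "edge_pt w g h 0 = node_pt g" by (simp add: edge_pt_def)

lemma pt_end: "(g, h) \<in> up s \<Longrightarrow> positive_weight w \<Longrightarrow> edge_pt w g h (w g h) = node_pt h"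
  by (auto simp: edge_pt_def positive_weight_def)

lemma pverts_sub: "pverts (weighted_subdivision w) = node_pt ` pverts H \<union> {edge_pt w g h i |g h i. (g, h) \<in> up s \<and> i \<le> w g h}"
  by (simp add: weighted_subdivision_def)

lemma nd_in_sub [simp]: "h \<in> pverts H \<Longrightarrow> node_pt h \<in> pverts (weighted_subdivision w)"
  by (auto simp: pverts_sub)

lemma pt_in_sub: "(g, h) \<in> up s \<Longrightarrow> i \<le> w g h \<Longrightarrow> edge_pt w g h i \<in> pverts (weighted_subdivision w)"
  by (auto simp: pverts_sub)

lemma parcs_sub: "parcs (weighted_subdivision w) = (\<Union>(g, h)\<in>up s. \<Union>i<w g h.
      {(edge_pt w g h i, edge_pt w g h (Suc i)), (edge_pt w g h (Suc i), edge_pt w g h i)})"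
  by (simp add: weighted_subdivision_def)

lemma parcs_subI:
  "(g, h) \<in> up s \<Longrightarrow> i < w g h \<Longrightarrow> (edge_pt w g h i, edge_pt w g h (Suc i)) \<in> parcs (weighted_subdivision w)"
  "(g, h) \<in> up s \<Longrightarrow> i < w g h \<Longrightarrow> (edge_pt w g h (Suc i), edge_pt w g h i) \<in> parcs (weighted_subdivision w)"
  by (auto simp: parcs_sub)

lemma parcs_subE:
  assumes "(x, y) \<in> parcs (weighted_subdivision w)"
  obtains g h i where "(g, h) \<in> up s" "i < w g h"
    "x = edge_pt w g h i \<and> y = edge_pt w g h (Suc i) \<or> x = edge_pt w g h (Suc i) \<and> y = edge_pt w g h i"
  using assms by (auto simp: parcs_sub)

lemma sub_cong:
  assumes "\<And>g h. (g, h) \<in> up s \<Longrightarrow> w g h = w' g h"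
  shows "weighted_subdivision w = weighted_subdivision w'"
proof -
  have edge_pt: "edge_pt w g h i = edge_pt w' g h i" if "(g, h) \<in> up s" for g h i
    using assms[OF that] by (simp add: edge_pt_def)
  have "{edge_pt w g h i |g h i. (g, h) \<in> up s \<and> i \<le> w g h} =
      {edge_pt w' g h i |g h i. (g, h) \<in> up s \<and> i \<le> w' g h}"
    using edge_pt assms by (metis (no_types, lifting))
  moreover have "(\<Union>(g, h)\<in>up s. \<Union>i<w g h.
      {(edge_pt w g h i, edge_pt w g h (Suc i)), (edge_pt w g h (Suc i), edge_pt w g h i)}) =
      (\<Union>(g, h)\<in>up s. \<Union>i<w' g h.
      {(edge_pt w' g h i, edge_pt w' g h (Suc i)), (edge_pt w' g h (Suc i), edge_pt w' g h i)})"
    using edge_pt assms by (intro SUP_cong) auto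
  ultimately show ?thesis by (simp add: weighted_subdivision_def)
qed

text \<open>Interior vertices keep their names when the weight of an edge grows, so increasing one
  weight by one inserts a single vertex just below the upper end of that edge.\<close>

lemma subdivide_last_arc:
  assumes gh: "(g, h) \<in> up s" and pos: "positive_weight w"
    and w': "w' = w(g := (w g)(h := Suc (w g h)))"
  shows "(edge_pt w g h (w g h - 1), node_pt h) \<in> parcs (weighted_subdivision w)"
    and "code (g, h, w g h) \<notin> pverts (weighted_subdivision w)"
    and "weighted_subdivision w' = subdivide (weighted_subdivision w) (edge_pt w g h (w g h - 1), node_pt h) (code (g, h, w g h))"
proof -
  note ghD = upD[OF gh]
  let ?n = "w g h" let ?x = "edge_pt w g h (w g h - 1)" let ?z = "code (g, h, w g h)"
  have n: "1 \<le> ?n" using pos gh by (auto simp: positive_weight_def)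
  have other: "edge_pt w' a b i = edge_pt w a b i" "w' a b = w a b" if "(a, b) \<noteq> (g, h)" for a b i
    using that by (auto simp: w' edge_pt_def)
  have n': "w' g h = Suc ?n" by (simp add: w')
  have below: "edge_pt w' g h i = edge_pt w g h i" if "i < ?n" for i
    using that by (auto simp: edge_pt_def w')
  have new: "edge_pt w' g h ?n = ?z" "edge_pt w' g h (Suc ?n) = node_pt h"
    using n by (auto simp: edge_pt_def w')
  have old: "edge_pt w g h ?n = node_pt h" using pt_end gh pos by blast
  show arc: "(?x, node_pt h) \<in> parcs (weighted_subdivision w)"
    using parcs_subI(1)[OF gh, of "?n - 1" w] n old by simp
  have dz: "decode ?z = (g, h, ?n)" using ghD by simp
  show "?z \<notin> pverts (weighted_subdivision w)"
  proof
    assume "?z \<in> pverts (weighted_subdivision w)"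
    then consider a where "a \<in> pverts H" "?z = node_pt a"
      | a b i where "(a, b) \<in> up s" "i \<le> w a b" "?z = edge_pt w a b i"
      by (auto simp: pverts_sub)
    then show False
    proof cases
      case 1
      then show False using dz ghD by auto
    next
      case 2
      then have "(g, h, ?n) = decode (edge_pt w a b i)" using dz by simp
      then show False using decode_pt[OF 2(1)] ghD n by (auto split: if_splits)
    qed
  qed
  have uniq: "(a, b) = (g, h) \<and> Suc i = ?n"
    if "(a, b) \<in> up s" "i < w a b" and
      e: "(edge_pt w a b i = ?x \<and> edge_pt w a b (Suc i) = node_pt h) \<or> (edge_pt w a b i = node_pt h \<and> edge_pt w a b (Suc i) = ?x)"
    for a b i
  proof -
    have dx: "decode ?x = (if ?n = 1 then (g, g, 0) else (g, h, ?n - 1))"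
      using decode_pt[OF gh, of w "?n - 1"] n by auto
    have dh: "decode (node_pt h) = (h, h, 0)" using ghD by simp
    have e1: "decode (edge_pt w a b i) = (if i = 0 then (a, a, 0) else (a, b, i))"
      using decode_pt[OF that(1), of w i] that(2) by simp
    have e2: "decode (edge_pt w a b (Suc i)) = (if Suc i = w a b then (b, b, 0) else (a, b, Suc i))"
      using decode_pt[OF that(1), of w "Suc i"] by simp
    have "a \<noteq> b" "(h, g) \<notin> up s" "g \<noteq> h" using ghD upD[OF that(1)] by auto
    moreover have "(decode (edge_pt w a b i) = decode ?x \<and> decode (edge_pt w a b (Suc i)) = (h, h, 0)) \<or>
      (decode (edge_pt w a b i) = (h, h, 0) \<and> decode (edge_pt w a b (Suc i)) = decode ?x)"
      using e dh by auto
    ultimately show ?thesis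
      unfolding dx e1 e2 using that(1) n
      by (cases "i = 0"; cases "Suc i = w a b"; cases "?n = 1") auto
  qed
  have V: "pverts (weighted_subdivision w') = pverts (weighted_subdivision w) \<union> {?z}"
  proof (intro equalityI subsetI)
    fix y assume "y \<in> pverts (weighted_subdivision w')"
    then consider "y \<in> node_pt ` pverts H"
      | a b i where "(a, b) \<in> up s" "i \<le> w' a b" "y = edge_pt w' a b i"
      by (auto simp: pverts_sub)
    then show "y \<in> pverts (weighted_subdivision w) \<union> {?z}"
    proof cases
      case 2
      show ?thesis
      proof (cases "(a, b) = (g, h)")
        case True
        then have "i < ?n \<or> i = ?n \<or> i = Suc ?n" using 2 n' by auto
        then have "y = edge_pt w g h i \<and> i < ?n \<or> y = ?z \<or> y = node_pt h" using 2 True below new by auto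
        then show ?thesis using pt_in_sub[OF gh, of i w] ghD by auto
      next
        case False
        then show ?thesis using 2 other by (auto simp: pverts_sub)
      qed
    qed (auto simp: pverts_sub)
  next
    fix y assume "y \<in> pverts (weighted_subdivision w) \<union> {?z}"
    then consider "y \<in> node_pt ` pverts H" | "y = ?z"
      | a b i where "(a, b) \<in> up s" "i \<le> w a b" "y = edge_pt w a b i"
      by (auto simp: pverts_sub)
    then show "y \<in> pverts (weighted_subdivision w')"
    proof cases
      case 2
      then have "y = edge_pt w' g h ?n" "?n \<le> w' g h" using new n' by auto
      then show ?thesis using gh unfolding pverts_sub by blast
    next
      case 3
      show ?thesis
      proof (cases "(a, b) = (g, h)")
        case True
        then have "y = edge_pt w' g h i \<and> i \<le> w' g h \<or> y = node_pt h" using 3 below n' old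
          by (metis Pair_inject le_SucI le_neq_implies_less)
        then show ?thesis using gh ghD unfolding pverts_sub by auto
      next
        case False
        then have "y = edge_pt w' a b i" "i \<le> w' a b" using 3 other by auto
        then show ?thesis using 3 unfolding pverts_sub by blast
      qed
    qed (auto simp: pverts_sub)
  qed
  have A: "parcs (weighted_subdivision w') = (parcs (weighted_subdivision w) - {(?x, node_pt h), (node_pt h, ?x)}) \<union>
      {(?x, ?z), (?z, ?x), (?z, node_pt h), (node_pt h, ?z)}" (is "_ = ?R")
  proof -
    have x': "edge_pt w' g h (?n - 1) = ?x" using below n by simp
    have sn: "Suc (?n - 1) = ?n" using n by simp
    have "p \<in> ?R" if p: "p \<in> parcs (weighted_subdivision w')" for p
    proof -
      obtain x y where [simp]: "p = (x, y)" by fastforce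
      obtain a b i where i: "(a, b) \<in> up s" "i < w' a b"
        "x = edge_pt w' a b i \<and> y = edge_pt w' a b (Suc i) \<or> x = edge_pt w' a b (Suc i) \<and> y = edge_pt w' a b i"
        using p parcs_subE by (metis \<open>p = (x, y)\<close>)
      consider "(a, b) \<noteq> (g, h)" | "(a, b) = (g, h)" "Suc i < ?n"
        | "(a, b) = (g, h)" "Suc i = ?n" | "(a, b) = (g, h)" "i = ?n"
        using i(2) n' by fastforce
      then show ?thesis
      proof cases
        case 1
        then have "i < w a b"
          "x = edge_pt w a b i \<and> y = edge_pt w a b (Suc i) \<or> x = edge_pt w a b (Suc i) \<and> y = edge_pt w a b i"
          using i other by auto
        moreover have "p \<noteq> (?x, node_pt h)" "p \<noteq> (node_pt h, ?x)"
          using uniq[OF i(1) \<open>i < w a b\<close>] 1 calculation(2) by auto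
        ultimately show ?thesis using parcs_subI[OF i(1)] by auto
      next
        case 2
        then have *: "x = edge_pt w g h i \<and> y = edge_pt w g h (Suc i) \<or> x = edge_pt w g h (Suc i) \<and> y = edge_pt w g h i"
          using i below by auto
        have "p \<noteq> (?x, node_pt h)" "p \<noteq> (node_pt h, ?x)"
          using uniq[OF gh, of i] 2 * by auto
        then show ?thesis using parcs_subI[OF gh, of i w] * 2 by auto
      next
        case 3
        moreover from 3 have "i = ?n - 1" by simp
        ultimately have "edge_pt w' a b i = ?x" "edge_pt w' a b (Suc i) = ?z" using new x' sn by auto
        then show ?thesis using i by auto
      next
        case 4
        then have "edge_pt w' a b i = ?z" "edge_pt w' a b (Suc i) = node_pt h" using new by auto
        then show ?thesis using i by auto
      qed
    qed
    moreover have "p \<in> parcs (weighted_subdivision w')" if p: "p \<in> ?R" for p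
    proof -
      obtain x y where [simp]: "p = (x, y)" by fastforce
      consider "(x, y) \<in> parcs (weighted_subdivision w)" "p \<noteq> (?x, node_pt h)" "p \<noteq> (node_pt h, ?x)"
        | "p \<in> {(?x, ?z), (?z, ?x)}" | "p \<in> {(?z, node_pt h), (node_pt h, ?z)}"
        using p by auto
      then show ?thesis
      proof cases
        case 1
        obtain a b i where i: "(a, b) \<in> up s" "i < w a b"
          "x = edge_pt w a b i \<and> y = edge_pt w a b (Suc i) \<or> x = edge_pt w a b (Suc i) \<and> y = edge_pt w a b i"
          using 1(1) parcs_subE by metis
        show ?thesis
        proof (cases "(a, b) = (g, h)")
          case True
          have "i = ?n - 1" if "Suc i = ?n" using that by simp
          then have "Suc i \<noteq> ?n" using i(3) 1(2,3) old True by auto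
          then have si: "Suc i < ?n" using i True by auto
          then have "x = edge_pt w' g h i \<and> y = edge_pt w' g h (Suc i) \<or> x = edge_pt w' g h (Suc i) \<and> y = edge_pt w' g h i"
            using i True below by auto
          then show ?thesis using parcs_subI[OF gh, of i w'] n' si by auto
        next
          case False
          then show ?thesis using i other parcs_subI[OF i(1), of i w'] by auto
        qed
      next
        case 2
        then show ?thesis using parcs_subI[OF gh, of "?n - 1" w'] n' x' new sn by auto
      next
        case 3
        then show ?thesis using parcs_subI[OF gh, of ?n w'] n' new by auto
      qed
    qed
    ultimately show ?thesis by blast
  qed
  show "weighted_subdivision w' = subdivide (weighted_subdivision w) (?x, node_pt h) ?z"
    using V A by (intro pair_pre_digraph.equality) simp_all
qed

text \<open>With unit weights nothing is subdivided: this is the isomorphic copy of H on the natural numbers.\<close>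

abbreviation copy :: "nat pair_pre_digraph" where "copy \<equiv> weighted_subdivision (\<lambda>_ _. Suc 0)"

lemma pverts_copy: "pverts copy = node_pt ` pverts H"
proof -
  have "edge_pt (\<lambda>_ _. Suc 0) g h i \<in> node_pt ` pverts H" if "(g, h) \<in> up s" "i \<le> Suc 0" for g h i
    using that upD[OF that(1)] by (auto simp: edge_pt_def)
  then show ?thesis unfolding pverts_sub by blast
qed

lemma parcs_copy: "parcs copy = (\<lambda>(g, h). (node_pt g, node_pt h)) ` parcs H"
proof (intro equalityI subsetI)
  fix p assume "p \<in> parcs copy"
  moreover obtain x y where p: "p = (x, y)" by fastforce
  ultimately have "(x, y) \<in> parcs copy" by simp
  then obtain g h where "(g, h) \<in> up s" "p = (node_pt g, node_pt h) \<or> p = (node_pt h, node_pt g)"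
    by (elim parcs_subE) (auto simp: edge_pt_def p)
  then show "p \<in> (\<lambda>(g, h). (node_pt g, node_pt h)) ` parcs H" using upD sym_arc by fastforce
next
  fix p assume "p \<in> (\<lambda>(g, h). (node_pt g, node_pt h)) ` parcs H"
  then obtain g h where "(g, h) \<in> parcs H" "p = (node_pt g, node_pt h)" by auto
  then show "p \<in> parcs copy"
    using up_or_down[of g h] parcs_subI[of _ _ 0 "\<lambda>_ _. Suc 0"] by (fastforce simp: edge_pt_def)
qed

lemma copy_iso: "digraph_iso (with_proj H) (with_proj copy)"
proof -
  define f where "f = \<lparr>iso_verts = node_pt, iso_arcs = (\<lambda>(g, h). (node_pt g, node_pt h)),
    iso_head = snd :: nat \<times> nat \<Rightarrow> nat, iso_tail = fst\<rparr>"
  have "inj_on node_pt (pverts H)" by (rule inj_onI) simp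
  moreover have "inj_on (\<lambda>(g, h). (node_pt g, node_pt h)) (parcs H)"
    by (rule inj_onI) (clarsimp, metis in_arcsD1 in_arcsD2 nd_eq_iff)
  ultimately have "digraph_isomorphism f"
    unfolding digraph_isomorphism_def using wf by (auto simp: f_def)
  moreover have "with_proj copy = app_iso f (with_proj H)"
    by (simp add: app_iso_def f_def with_proj_def pverts_copy parcs_copy)
  ultimately show ?thesis unfolding digraph_iso_def by blast
qed

lemma pair_graph_copy: "pair_graph copy"
proof
  have "node_pt a \<noteq> node_pt b" if "(a, b) \<in> parcs H" for a b
    using that no_loops' in_arcsD1 in_arcsD2 by (metis nd_eq_iff)
  then show "fst e \<noteq> snd e" if "e \<in> parcs copy" for e
    using that unfolding parcs_copy by fastforce
  show "symmetric (with_proj copy)"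
    by (auto simp: symmetric_def sym_def parcs_copy intro: rev_image_eqI[OF sym_arc])
qed (auto simp: parcs_copy pverts_copy pair_finite_verts pair_finite_arcs
    dest: in_arcsD1 in_arcsD2)

text \<open>Induction on the total weight, removing the last interior vertex of some edge.\<close>

lemma subdivision_pair_sub:
  assumes "positive_weight w"
  shows "subdivision_pair copy (weighted_subdivision w)"
  using assms
proof (induct "\<Sum>(g, h)\<in>up s. w g h" arbitrary: w rule: less_induct)
  case less
  show ?case
  proof (cases "\<forall>(g, h)\<in>up s. w g h = 1")
    case True
    then have "weighted_subdivision w = copy" by (intro sub_cong) auto
    moreover have "pair_bidirected_digraph copy"
      using pair_graph_copy by (simp add: pair_graph_def pair_bidirected_digraph_def
          pair_digraph_def pair_pseudo_graph_def)
    ultimately show ?thesis using subdivision_pair_base by metis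
  next
    case False
    then obtain g h where gh: "(g, h) \<in> up s" "w g h \<noteq> 1" by auto
    then have w1: "w g h > 1" using less(2) by (fastforce simp: positive_weight_def)
    define v where "v = w(g := (w g)(h := w g h - 1))"
    have pos: "positive_weight v" using less(2) w1 by (auto simp: positive_weight_def v_def)
    have w: "w = v(g := (v g)(h := Suc (v g h)))" using w1 by (auto simp: v_def fun_eq_iff)
    have "(\<Sum>(g, h)\<in>up s. v g h) < (\<Sum>(g, h)\<in>up s. w g h)"
      using gh w1 by (intro sum_strict_mono_ex1[OF finite_up]) (auto simp: v_def intro!: bexI[of _ "(g, h)"])
    then have "subdivision_pair copy (weighted_subdivision v)" using less(1) pos by blast
    then show ?thesis
      using subdivide_last_arc[OF gh(1) pos w] subdivision_pair_divide by metis
  qed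
qed

lemma sub_in_subdivisions: "positive_weight w \<Longrightarrow> weighted_subdivision w \<in> subdivisions H"
  using copy_iso subdivision_pair_sub by (auto simp: subdivisions_def)

lemma pair_graph_sub: "positive_weight w \<Longrightarrow> pair_graph (weighted_subdivision w)"
  using pair_graph.pair_graph_subdivision[OF pair_graph_copy subdivision_pair_sub] .

lemma pt_relpow:
  assumes "(g, h) \<in> up s" "i \<le> j" "j \<le> w g h"
  shows "(edge_pt w g h i, edge_pt w g h j) \<in> parcs (weighted_subdivision w) ^^ (j - i)"
  using assms(2,3)
proof (induct j rule: dec_induct)
  case (step n)
  then have "(edge_pt w g h n, edge_pt w g h (Suc n)) \<in> parcs (weighted_subdivision w)" using parcs_subI assms by simp
  then show ?case using step by (auto simp: Suc_diff_le)
qed simp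

lemma conn_graph_sub:
  assumes "positive_weight w"
  shows "conn_graph (weighted_subdivision w)"
proof -
  interpret K: pair_graph "weighted_subdivision w" using pair_graph_sub assms .
  have node: "(node_pt s, node_pt h) \<in> (parcs (weighted_subdivision w))\<^sup>*" if "h \<in> pverts H" for h
    using up_from_root[OF root that]
  proof (induct rule: rtrancl_induct)
    case (step g h)
    have "(edge_pt w g h 0, edge_pt w g h (w g h)) \<in> (parcs (weighted_subdivision w))\<^sup>*"
      using pt_relpow[OF step(2), of 0 "w g h" w] relpow_imp_rtrancl by blast
    then show ?case using step pt_end[OF step(2) assms] by simp
  qed simp
  have reach_all: "(node_pt s, z) \<in> (parcs (weighted_subdivision w))\<^sup>*" if z: "z \<in> pverts (weighted_subdivision w)" for z
  proof -
    consider h where "h \<in> pverts H" "z = node_pt h"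
      | g h i where "(g, h) \<in> up s" "i \<le> w g h" "z = edge_pt w g h i"
      using z by (auto simp: pverts_sub)
    then show ?thesis
    proof cases
      case 2
      have "(node_pt g, z) \<in> (parcs (weighted_subdivision w))\<^sup>*"
        using pt_relpow[OF 2(1), of 0 i w] relpow_imp_rtrancl 2 by fastforce
      then show ?thesis using node upD[OF 2(1)] by (meson rtrancl_trans)
    qed (use node in auto)
  qed
  have "sym ((parcs (weighted_subdivision w))\<^sup>*)"
    by (rule sym_rtrancl) (auto simp: sym_def intro: K.arcs_symmetric)
  then have "(x, y) \<in> (parcs (weighted_subdivision w))\<^sup>*" if "x \<in> pverts (weighted_subdivision w)" "y \<in> pverts (weighted_subdivision w)" for x y
    using reach_all[OF that(1)] reach_all[OF that(2)] by (meson rtrancl_trans symD)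
  moreover have "pverts (weighted_subdivision w) \<noteq> {}" using root by (auto simp: pverts_sub)
  ultimately show ?thesis
    using K.pair_graph connected_pair_graph_iff[OF K.pair_graph] by (simp add: conn_graph_def)
qed

lemma dist_pt_le:
  assumes "positive_weight w" "(g, h) \<in> up s" "i \<le> j" "j \<le> w g h"
  shows "ndist (with_proj (weighted_subdivision w)) (edge_pt w g h i) (edge_pt w g h j) \<le> j - i"
proof -
  interpret K: connected_graph "weighted_subdivision w" using conn_graph_sub assms by unfold_locales
  show ?thesis using K.d_le_relpow[OF pt_relpow[of g h i j w, OF assms(2-4)]] pt_in_sub assms by simp
qed

lemma dist_edge_le:
  assumes "positive_weight w" "(g, h) \<in> up s"
  shows "ndist (with_proj (weighted_subdivision w)) (node_pt g) (node_pt h) \<le> w g h"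
  using dist_pt_le[OF assms, of 0 "w g h"] pt_end[OF assms(2,1)] by simp

text \<open>A potential on the nodes extends along the subdivided edges: at an interior vertex it takes
  the largest value that the two ends permit.\<close>

lemma dist_potential:
  fixes f :: "'h \<Rightarrow> int"
  assumes pos: "positive_weight w" and f: "\<And>g h. (g, h) \<in> up s \<Longrightarrow> \<bar>f g - f h\<bar> \<le> int (w g h)"
    and ab: "a \<in> pverts H" "b \<in> pverts H"
  shows "\<bar>f a - f b\<bar> \<le> int (ndist (with_proj (weighted_subdivision w)) (node_pt a) (node_pt b))"
proof -
  interpret K: connected_graph "weighted_subdivision w" using conn_graph_sub pos by unfold_locales
  define F where "F z = (case decode z of (g, h, i) \<Rightarrow>
    if g = h then f g else min (f g + int i) (f h + int (w g h) - int i))" for z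
  have F_pt: "F (edge_pt w g h i) = min (f g + int i) (f h + int (w g h) - int i)"
    if "(g, h) \<in> up s" "i \<le> w g h" for g h i
    using f[OF that(1)] upD[OF that(1)] that(2) by (auto simp: F_def decode_pt[OF that(1)])
  have "\<bar>F x - F y\<bar> \<le> 1" if "(x, y) \<in> parcs (weighted_subdivision w)" for x y
    using that by (rule parcs_subE) (auto simp: F_pt)
  then have "\<bar>F (node_pt a) - F (node_pt b)\<bar> \<le> int (K.d (node_pt a) (node_pt b))"
    using ab by (intro K.lipschitz) auto
  then show ?thesis using ab by (simp add: F_def)
qed

end

section \<open>Free nodes of a vertical chain\<close>

context coded_layered_graph
begin

lemma sipco_sub_le:
  assumes "sipco_class (subdivisions H) \<le> enat k" "positive_weight w"
  shows "sipco (with_proj (weighted_subdivision w)) \<le> k"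
proof -
  have "enat (sipco (with_proj (weighted_subdivision w))) \<le> sipco_class (subdivisions H)"
    unfolding sipco_class_def using sub_in_subdivisions[OF assms(2)] by (rule SUP_upper)
  then show ?thesis using assms(1) by (metis enat_ord_simps(1) order_trans)
qed

text \<open>The nodes of F are free: from each of them a vertical path leads to s and avoids the chain C.
  The weights below put all of them at the same distance M from s. Since vertices on a common
  rooted isometric path have different distances from the root, a rooted path contains at most one
  node of F. But the chain is an isometric path, so k rooted paths cover it.\<close>

lemma card_free_chain_nodes_le:
  assumes sip: "sipco_class (subdivisions H) \<le> enat k"
    and chain: "\<And>i. i < m \<Longrightarrow> (c i, c (Suc i)) \<in> up s" and c0: "c 0 \<in> pverts H"
    and C: "C = c ` {..m}" and F: "F \<subseteq> C"
    and free: "\<And>x. x \<in> F \<Longrightarrow> \<exists>u. (u, x) \<in> up s \<and> u \<notin> C \<and> (s, u) \<in> (up s \<inter> (- C) \<times> (- C))\<^sup>*"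
  shows "card F \<le> k"
proof (cases "F = {}")
  case False
  define N where "N = Max (d s ` pverts H)"
  have N: "d s x \<le> N" if "x \<in> pverts H" for x
    using that pair_finite_verts by (simp add: N_def)
  define M where "M = 2 * N + 2"
  \<comment> \<open>An edge entering C from a node in layer i has weight M - i, so that every vertical path that
    first meets C through it has length M there.\<close>
  define w where "w g h = (if g \<in> C \<longleftrightarrow> h \<in> C then 1 else if g \<in> C then M - d s h else M - d s g)"
    for g h
  have pos: "positive_weight w"
    using N upD(2,3) by (fastforce simp: positive_weight_def w_def M_def)
  interpret K: connected_graph "weighted_subdivision w" using conn_graph_sub pos by unfold_locales
  have cv: "c i \<in> pverts H" if "i \<le> m" for i
    using that chain upD(3) c0 by (cases i) (auto simp: Suc_le_eq)
  have cL: "d s (c i) = d s (c 0) + i" if "i \<le> m" for i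
    using that by (induct i) (simp_all add: upD(5)[OF chain])
  have CV: "C \<subseteq> pverts H" using cv C by auto
  have sC: "s \<notin> C"
  proof -
    obtain u where "u \<notin> C" "(s, u) \<in> (up s \<inter> (- C) \<times> (- C))\<^sup>*" using free False by blast
    then show ?thesis by (metis (no_types) ComplD IntD2 SigmaD1 converse_rtranclE)
  qed
  \<comment> \<open>Every free node lies at distance exactly M from the root.\<close>
  have dist_free: "K.d (node_pt s) (node_pt x) = M" if x: "x \<in> F" for x
  proof -
    obtain u where u: "(u, x) \<in> up s" "u \<notin> C" "(s, u) \<in> (up s \<inter> (- C) \<times> (- C))\<^sup>*"
      using free[OF x] by blast
    have xC: "x \<in> C" using x F by auto
    have "K.d (node_pt s) (node_pt u) \<le> d s u" using u(3)
    proof (induct rule: rtrancl_induct)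
      case base
      then show ?case using root by simp
    next
      case (step g h)
      then have gh: "(g, h) \<in> up s" "w g h = 1" by (auto simp: w_def)
      have "K.d (node_pt s) (node_pt h) \<le> K.d (node_pt s) (node_pt g) + K.d (node_pt g) (node_pt h)"
        using K.d_triangle root upD[OF gh(1)] by simp
      then show ?case using step(3) dist_edge_le[OF pos gh(1)] gh upD[OF gh(1)] by simp
    qed
    moreover have "K.d (node_pt u) (node_pt x) \<le> M - d s u"
      using dist_edge_le[OF pos u(1)] u(2) xC by (simp add: w_def)
    moreover have "K.d (node_pt s) (node_pt x) \<le> K.d (node_pt s) (node_pt u) + K.d (node_pt u) (node_pt x)"
      using K.d_triangle root upD[OF u(1)] by simp
    ultimately have "K.d (node_pt s) (node_pt x) \<le> M"
      using N[of u] upD[OF u(1)] by (simp add: M_def)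
    moreover
    \<comment> \<open>This potential shows that M is also a lower bound.\<close>
    define f where "f y = (if y \<in> C then int M else int (d s y))" for y
    have "\<bar>f g - f h\<bar> \<le> int (w g h)" if "(g, h) \<in> up s" for g h
      using N[of g] N[of h] upD[OF that]
      by (cases "g \<in> C"; cases "h \<in> C") (simp_all add: f_def w_def M_def)
    then have "\<bar>f s - f x\<bar> \<le> int (K.d (node_pt s) (node_pt x))"
      using root CV xC by (intro dist_potential[OF pos]) auto
    then have "M \<le> K.d (node_pt s) (node_pt x)" using sC xC root by (simp add: f_def)
    ultimately show ?thesis by simp
  qed
  define P where "P = map (\<lambda>i. node_pt (c i)) [0..<Suc m]"
  have P_nth: "P ! i = node_pt (c i)" if "i \<le> m" for i using that by (simp add: P_def del: upt_Suc)
  have lenP: "length P = Suc m" "P \<noteq> []" by (auto simp: P_def)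
  have hdP: "hd P = node_pt (c 0)" "last P = node_pt (c m)"
    using P_nth lenP by (auto simp: hd_conv_nth last_conv_nth)
  have arcP: "(node_pt (c i), node_pt (c (Suc i))) \<in> parcs (weighted_subdivision w)" if "i < m" for i
  proof -
    have "w (c i) (c (Suc i)) = 1" using that C by (auto simp: w_def)
    then show ?thesis
      using parcs_subI(1)[OF chain[OF that], of 0 w] pt_end[OF chain[OF that] pos] by simp
  qed
  have walk: "vwalk P (with_proj (weighted_subdivision w))"
  proof -
    have "vwalk (map (\<lambda>i. node_pt (c i)) [i..<Suc m]) (with_proj (weighted_subdivision w))" if "i \<le> m" for i
      using that
    proof (induct i rule: inc_induct)
      case base
      then show ?case using cv by simp
    next
      case (step i)
      then have "[i..<Suc m] = i # [Suc i..<Suc m]" "[Suc i..<Suc m] \<noteq> []"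
        by (auto simp: upt_conv_Cons)
      moreover have "hd (map (\<lambda>i. node_pt (c i)) [Suc i..<Suc m]) = node_pt (c (Suc i))"
        using step by (simp add: hd_map del: upt_Suc)
      ultimately show ?case
        using step K.vwalk_wf_digraph_consI[of "map (\<lambda>i. node_pt (c i)) [Suc i..<Suc m]" "node_pt (c i)"]
          arcP[of i] by simp
    qed
    then show ?thesis by (simp add: P_def)
  qed
  \<comment> \<open>Leaving the chain costs more than walking along all of it, so the chain is isometric.\<close>
  define f where "f y = (if y \<in> C then int (d s y) else 0)" for y
  have "\<bar>f g - f h\<bar> \<le> int (w g h)" if "(g, h) \<in> up s" for g h
    using N[of g] N[of h] upD[OF that]
    by (cases "g \<in> C"; cases "h \<in> C") (simp_all add: f_def w_def M_def)
  then have "\<bar>f (c 0) - f (c m)\<bar> \<le> int (K.d (node_pt (c 0)) (node_pt (c m)))"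
    using cv by (intro dist_potential[OF pos]) auto
  then have "m \<le> K.d (node_pt (c 0)) (node_pt (c m))" using cL[of m] C by (simp add: f_def)
  moreover have "K.d (node_pt (c 0)) (node_pt (c m)) \<le> m"
    using K.vwalk_nth_d[OF walk, of 0 m] P_nth lenP by simp
  ultimately have "isometric_path (with_proj (weighted_subdivision w)) P"
    using walk lenP hdP by (simp add: K.isometric_path_iff)
  then obtain Q where Q: "finite Q" "card Q \<le> k" "covered_by P Q"
    "\<And>q. q \<in> Q \<Longrightarrow> rooted_isometric_path (with_proj (weighted_subdivision w)) (node_pt s) q"
    using K.sipco_cover[OF sipco_sub_le[OF sip pos], of "node_pt s" P] root by auto
  have "node_pt x \<in> set P" if "x \<in> F" for x
    using that F C by (auto simp: P_def simp del: upt_Suc)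
  then have "\<exists>q\<in>Q. node_pt x \<in> set q" if "x \<in> F" for x
    using Q(3) that by (auto simp: covered_by_def)
  then obtain q where q: "\<And>x. x \<in> F \<Longrightarrow> q x \<in> Q \<and> node_pt x \<in> set (q x)" by metis
  have eq: "x = y" if "x \<in> F" "y \<in> F" "(node_pt x, node_pt y) \<in> (K.up (node_pt s))\<^sup>*" for x y
  proof -
    have v: "x \<in> pverts H" "y \<in> pverts H" using that F CV by auto
    have "K.d (node_pt x) (node_pt y) = 0"
      using K.up_dist[OF that(3)] v root dist_free that(1,2) by simp
    then show ?thesis using K.d_zeroD v by (metis nd_eq_iff nd_in_sub)
  qed
  have "inj_on q F"
  proof (rule inj_onI)
    fix x y assume xy: "x \<in> F" "y \<in> F" "q x = q y"
    have "node_pt x \<in> set (q x)" "node_pt y \<in> set (q x)" using q[OF xy(1)] q[OF xy(2)] xy(3) by auto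
    then show "x = y"
      using K.rooted_path_comparable[OF Q(4), of "q x" "node_pt x" "node_pt y"] eq xy q by metis
  qed
  then have "card F \<le> card Q" using q Q(1) by (intro card_inj_on_le[of q]) auto
  then show ?thesis using Q(2) by simp
qed simp

end

section \<open>Subdivisions that realise a grading\<close>

text \<open>If the weight of each up edge is the difference of the grades of its ends, then all vertical
  paths from s to a node have the same length, and the subdivision is layered by its own distance
  from s.\<close>

locale graded_subdivision = coded_layered_graph H s code
  for H :: "'h pair_pre_digraph" and s code +
  fixes w :: "'h \<Rightarrow> 'h \<Rightarrow> nat" and grade :: "'h \<Rightarrow> nat"
  assumes pos: "positive_weight w"
    and grade_root: "grade s = 0"
    and grade_up: "(g, h) \<in> up s \<Longrightarrow> grade h = grade g + w g h"
begin

abbreviation K :: "nat pair_pre_digraph" where "K \<equiv> weighted_subdivision w"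

sublocale K: connected_graph K using conn_graph_sub pos by unfold_locales

definition elevation :: "nat \<Rightarrow> nat" where
  "elevation z = (case decode z of (g, h, i) \<Rightarrow> grade g + i)"

text \<open>The lower end of the subdivided edge that contains the vertex; a node is its own base.\<close>

definition base :: "nat \<Rightarrow> 'h" where "base z = fst (decode z)"

lemma ht_nd [simp]: "h \<in> pverts H \<Longrightarrow> elevation (node_pt h) = grade h" by (simp add: elevation_def)

lemma base_nd [simp]: "h \<in> pverts H \<Longrightarrow> base (node_pt h) = h" by (simp add: base_def)

lemma ht_pt: "(g, h) \<in> up s \<Longrightarrow> elevation (edge_pt w g h i) = grade g + i"
  using decode_pt[of g h w i] grade_up[of g h] by (auto simp: elevation_def)

lemma base_pt: "(g, h) \<in> up s \<Longrightarrow> i < w g h \<Longrightarrow> base (edge_pt w g h i) = g"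
  using decode_pt[of g h w i] by (auto simp: base_def)

lemma base_pt_end: "(g, h) \<in> up s \<Longrightarrow> base (edge_pt w g h (w g h)) = h"
  using pt_end[of g h w] pos upD(3) by simp

text \<open>A vertex is a node or an interior vertex of a subdivided edge, described from its lower end.\<close>

lemma K_vertE:
  assumes "z \<in> pverts K"
  obtains (node) h where "h \<in> pverts H" "z = node_pt h"
    | (inner) g h i where "(g, h) \<in> up s" "0 < i" "i < w g h" "z = edge_pt w g h i"
proof -
  consider h where "h \<in> pverts H" "z = node_pt h"
    | g h i where "(g, h) \<in> up s" "i \<le> w g h" "z = edge_pt w g h i"
    using assms by (auto simp: pverts_sub)
  then show thesis
  proof cases
    case 2
    then consider "i = 0" | "i = w g h" | "0 < i" "i < w g h" by linarith
    then show thesis using 2 that upD[OF 2(1)] pt_end[OF 2(1) pos] by cases auto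
  qed (use that in blast)
qed

lemma base_in: "z \<in> pverts K \<Longrightarrow> base z \<in> pverts H"
  by (erule K_vertE) (auto simp: base_pt dest: upD)

lemma arc_ht:
  assumes "(x, y) \<in> parcs K"
  shows "elevation y = Suc (elevation x) \<or> elevation x = Suc (elevation y)"
  using assms by (rule parcs_subE) (auto simp: ht_pt)

lemma dist_base:
  assumes "z \<in> pverts K"
  shows "K.d (node_pt (base z)) z + grade (base z) \<le> elevation z"
  using assms
proof (cases rule: K_vertE)
  case (node h)
  then show ?thesis by simp
next
  case (inner g h i)
  then show ?thesis
    using dist_pt_le[OF pos inner(1), of 0 i] by (simp add: base_pt ht_pt)
qed

lemma chain_dist:
  assumes "(g, h) \<in> (up s)\<^sup>*" "g \<in> pverts H"
  shows "K.d (node_pt g) (node_pt h) + grade g \<le> grade h"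
  using assms(1)
proof (induct rule: rtrancl_induct)
  case base
  then show ?case using assms(2) by simp
next
  case (step h h')
  have "h \<in> pverts H" "h' \<in> pverts H" using upD[OF step(2)] by auto
  then have "K.d (node_pt g) (node_pt h') \<le> K.d (node_pt g) (node_pt h) + K.d (node_pt h) (node_pt h')"
    using K.d_triangle assms(2) by simp
  then show ?case using step(3) dist_edge_le[OF pos step(2)] grade_up[OF step(2)] by simp
qed

lemma root_dist:
  assumes "z \<in> pverts K"
  shows "K.d (node_pt s) z = elevation z"
proof (rule antisym)
  have "base z \<in> pverts H" using base_in assms by blast
  then have "K.d (node_pt s) (node_pt (base z)) \<le> grade (base z)"
    using chain_dist[OF up_from_root[OF root], of "base z"] root grade_root by simp
  moreover have "K.d (node_pt s) z \<le> K.d (node_pt s) (node_pt (base z)) + K.d (node_pt (base z)) z"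
    using K.d_triangle root \<open>base z \<in> pverts H\<close> assms by simp
  ultimately show "K.d (node_pt s) z \<le> elevation z" using dist_base[OF assms] by simp
  have "\<bar>int (elevation (node_pt s)) - int (elevation z)\<bar> \<le> int (K.d (node_pt s) z)"
    by (rule K.lipschitz) (use arc_ht root assms in fastforce)+
  then show "elevation z \<le> K.d (node_pt s) z" using root grade_root by simp
qed

lemma arc_base:
  assumes "(x, y) \<in> parcs K"
  shows "base x = base y \<or> (base x, base y) \<in> parcs H"
  using assms
proof (rule parcs_subE)
  fix g h i
  assume gh: "(g, h) \<in> up s" "i < w g h"
    "x = edge_pt w g h i \<and> y = edge_pt w g h (Suc i) \<or> x = edge_pt w g h (Suc i) \<and> y = edge_pt w g h i"
  have "base (edge_pt w g h (Suc i)) \<in> {g, h}"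
    using base_pt[OF gh(1), of "Suc i"] base_pt_end[OF gh(1)] gh(2) by (cases "Suc i = w g h") auto
  then show ?thesis using gh base_pt[OF gh(1,2)] upD(1)[OF gh(1)] sym_arc by auto
qed

text \<open>An ascending step in the subdivision stays on one edge or completes it, so ascending paths
  project to vertical paths of H.\<close>

lemma up_base:
  assumes "(x, y) \<in> K.up (node_pt s)"
  shows "base x = base y \<or> (base x, base y) \<in> up s"
proof -
  have arc: "(x, y) \<in> parcs K" using assms by (auto simp: K.up_def)
  then have v: "x \<in> pverts K" "y \<in> pverts K" using K.in_arcsD1 K.in_arcsD2 by auto
  have elevation: "elevation y = Suc (elevation x)" using assms root_dist v by (auto simp: K.up_def)
  show ?thesis
    using arc
  proof (rule parcs_subE)
    fix g h i
    assume gh: "(g, h) \<in> up s" "i < w g h"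
      "x = edge_pt w g h i \<and> y = edge_pt w g h (Suc i) \<or> x = edge_pt w g h (Suc i) \<and> y = edge_pt w g h i"
    then have "x = edge_pt w g h i" "y = edge_pt w g h (Suc i)" using elevation by (auto simp: ht_pt)
    then show ?thesis
      using gh base_pt[OF gh(1)] base_pt_end[OF gh(1)] by (cases "Suc i = w g h") auto
  qed
qed

lemma ups_base: "(x, y) \<in> (K.up (node_pt s))\<^sup>* \<Longrightarrow> (base x, base y) \<in> (up s)\<^sup>*"
  by (induct rule: rtrancl_induct) (auto dest: up_base intro: rtrancl_into_rtrancl)

lemma ht_base_bound:
  assumes "z \<in> pverts K" "\<And>g h. (g, h) \<in> up s \<Longrightarrow> w g h \<le> Suc b"
  shows "elevation z \<le> grade (base z) + b"
  using assms(1)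
proof (cases rule: K_vertE)
  case (inner g h i)
  then show ?thesis using assms(2)[OF inner(1)] by (simp add: base_pt ht_pt)
qed simp

end

section \<open>Trees and treewidth\<close>

text \<open>Trees are handled through a parent function and a depth. This agrees with the definition
  by the absence of cycles, by \<open>undirected_tree_rooted\<close> and
  \<open>rooted_undirected_tree\<close>.\<close>

definition rooted_tree :: "'t pair_pre_digraph \<Rightarrow> 't \<Rightarrow> ('t \<Rightarrow> 't) \<Rightarrow> ('t \<Rightarrow> nat) \<Rightarrow> bool" where
  "rooted_tree T \<rho> par dep \<longleftrightarrow> \<rho> \<in> pverts T \<and>
    (\<forall>v\<in>pverts T. v \<noteq> \<rho> \<longrightarrow> (v, par v) \<in> parcs T \<and> dep v = Suc (dep (par v))) \<and>
    (\<forall>(u, v)\<in>parcs T. v \<noteq> \<rho> \<and> u = par v \<or> u \<noteq> \<rho> \<and> v = par u)"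

lemma rooted_treeD:
  assumes "rooted_tree T \<rho> par dep"
  shows "\<rho> \<in> pverts T"
    and "\<And>v. v \<in> pverts T \<Longrightarrow> v \<noteq> \<rho> \<Longrightarrow> (v, par v) \<in> parcs T"
    and "\<And>v. v \<in> pverts T \<Longrightarrow> v \<noteq> \<rho> \<Longrightarrow> dep v = Suc (dep (par v))"
    and "\<And>u v. (u, v) \<in> parcs T \<Longrightarrow> v \<noteq> \<rho> \<and> u = par v \<or> u \<noteq> \<rho> \<and> v = par u"
  using assms by (auto simp: rooted_tree_def)

lemma vwalk_arcs_pcas:
  assumes "q \<noteq> []"
  shows "pcas (hd q) (vwalk_arcs q) (last q)" "pawalk_verts (hd q) (vwalk_arcs q) = q"
  using assms by (induct q rule: vwalk_arcs.induct) auto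

text \<open>A path joining two neighbours of v off v would close up to a cycle through v.\<close>

lemma tree_neighbours_separated:
  assumes T: "undirected_tree T" and va: "(v, a) \<in> parcs T" and vb: "(v, b) \<in> parcs T"
    and ab: "(a, b) \<in> (parcs T \<inter> (- {v}) \<times> (- {v}))\<^sup>*"
  shows "a = b"
proof (rule ccontr)
  assume "a \<noteq> b"
  interpret connected_graph T using T by unfold_locales (simp add: undirected_tree_def)
  let ?T = "with_proj T \<restriction> (pverts T - {v})"
  interpret I: wf_digraph ?T by (rule wellformed_induce_subgraph)
  have ends: "arcs_ends ?T = parcs T \<inter> (pverts T - {v}) \<times> (pverts T - {v})"
    by (auto simp: arcs_ends_conv)
  have "a \<in> pverts T - {v}" using va no_loops' in_arcsD2 by blast
  moreover have "parcs T \<inter> (- {v}) \<times> (- {v}) = arcs_ends ?T"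
    unfolding ends by (auto dest: in_arcsD1 in_arcsD2)
  ultimately have "a \<rightarrow>\<^sup>*\<^bsub>?T\<^esub> b" using ab I.reachable_conv'[of a b] by simp
  then obtain p where p: "vpath p ?T" "hd p = a" "last p = b"
    using I.reachable_vpath_conv by blast
  then have pv: "set p \<subseteq> pverts T - {v}" "set (vwalk_arcs p) \<subseteq> parcs T" "p \<noteq> []" "distinct p"
    by (auto simp: vpath_def vwalk_def ends)
  have len: "2 \<le> length p" using p pv(3) \<open>a \<noteq> b\<close> by (cases p rule: vwalk_arcs.cases) auto
  define q where "q = v # p @ [v]"
  have arcs_q: "vwalk_arcs q = (v, a) # vwalk_arcs p @ [(b, v)]"
    using pv(3) p by (simp add: q_def vwalk_arcs_append)
  have "awalk v (vwalk_arcs q) v"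
    using vwalk_arcs_pcas(1)[of q] pv va sym_arc[OF vb] in_arcsD1[OF va]
    unfolding awalk_def arcs_q by (auto simp: q_def arcs_q[unfolded q_def])
  moreover have "distinct (tl (awalk_verts v (vwalk_arcs q)))"
    using vwalk_arcs_pcas(2)[of q] pv by (auto simp: q_def)
  ultimately have "cycle (vwalk_arcs q)" by (auto simp: cycle_def arcs_q)
  moreover have "3 \<le> length (vwalk_arcs q)"
    using len vwalk_length_simp[of q] unfolding vwalk_length_def by (simp add: q_def)
  ultimately show False using T by (auto simp: undirected_tree_def)
qed

text \<open>Take the distance from any vertex as depth. Two neighbours of v that are not deeper than v are
  both joined to the root off v, so they coincide.\<close>

lemma undirected_tree_rooted:
  assumes T: "undirected_tree T"
  shows "\<exists>\<rho> par dep. rooted_tree T \<rho> par dep"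
proof -
  interpret connected_graph T using T by unfold_locales (simp add: undirected_tree_def)
  obtain \<rho> where \<rho>: "\<rho> \<in> pverts T" using ex_vert by blast
  have avoid: "(x, y) \<in> (parcs T \<inter> (- {v}) \<times> (- {v}))\<^sup>*"
    if "(x, y) \<in> (up \<rho>)\<^sup>*" "y \<noteq> v" "d \<rho> y \<le> d \<rho> v" for x y v
    using that
  proof (induct rule: rtrancl_induct)
    case (step y z)
    then have yz: "(y, z) \<in> parcs T" "d \<rho> y < d \<rho> v" by (auto simp: up_def)
    then have "y \<noteq> v" by auto
    then have "(y, z) \<in> parcs T \<inter> (- {v}) \<times> (- {v})" using yz step(4) by simp
    moreover have "(x, y) \<in> (parcs T \<inter> (- {v}) \<times> (- {v}))\<^sup>*"
      using step(3) yz(2) \<open>y \<noteq> v\<close> by simp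
    ultimately show ?case by (rule rtrancl_into_rtrancl[rotated])
  qed simp
  have uniq: "a = b"
    if "(v, a) \<in> parcs T" "(v, b) \<in> parcs T" "d \<rho> a \<le> d \<rho> v" "d \<rho> b \<le> d \<rho> v" for v a b
  proof -
    let ?R = "parcs T \<inter> (- {v}) \<times> (- {v})"
    have "(\<rho>, a) \<in> ?R\<^sup>*" "(\<rho>, b) \<in> ?R\<^sup>*"
      using avoid up_from_root[OF \<rho>] that no_loops' in_arcsD2 by metis+
    moreover have "sym (?R\<^sup>*)" by (rule sym_rtrancl) (auto simp: sym_def intro: sym_arc)
    ultimately have "(a, b) \<in> ?R\<^sup>*" by (meson rtrancl_trans symD)
    then show ?thesis using tree_neighbours_separated[OF T] that by blast
  qed
  obtain par where par: "\<And>v. v \<in> pverts T \<Longrightarrow> v \<noteq> \<rho> \<Longrightarrow> (par v, v) \<in> up \<rho>"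
    using ex_lower[OF \<rho>] by metis
  have toward: "v \<noteq> \<rho> \<and> u = par v" if "(u, v) \<in> parcs T" "d \<rho> u \<le> d \<rho> v" for u v
  proof
    have v: "u \<in> pverts T" "v \<in> pverts T" "u \<noteq> v" using that in_arcsD1 in_arcsD2 no_loops' by auto
    show "v \<noteq> \<rho>" using that v d_zeroD[of \<rho> u] \<rho> by auto
    then have "(par v, v) \<in> parcs T" "d \<rho> (par v) \<le> d \<rho> v" using par v by (auto simp: up_def)
    then show "u = par v" using uniq[of v u "par v"] that sym_arc by blast
  qed
  have "rooted_tree T \<rho> par (d \<rho>)"
    unfolding rooted_tree_def
  proof (intro conjI ballI impI)
    show "\<rho> \<in> pverts T" by fact
    fix v assume "v \<in> pverts T" "v \<noteq> \<rho>"
    then show "(v, par v) \<in> parcs T" "d \<rho> v = Suc (d \<rho> (par v))"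
      using par sym_arc by (auto simp: up_def)
  next
    fix e assume "e \<in> parcs T"
    moreover obtain u v where "e = (u, v)" by fastforce
    ultimately show "case e of (u, v) \<Rightarrow> v \<noteq> \<rho> \<and> u = par v \<or> u \<noteq> \<rho> \<and> v = par u"
      using toward[of u v] toward[of v u] sym_arc by (cases "d \<rho> u \<le> d \<rho> v") auto
  qed
  then show ?thesis by blast
qed

text \<open>On a cycle, a vertex of greatest depth has two distinct neighbours that are not deeper, but
  only its parent is such a neighbour.\<close>

lemma rooted_undirected_tree:
  assumes T: "pair_graph T" and rt: "rooted_tree T \<rho> par dep"
  shows "undirected_tree T"
proof -
  interpret pair_graph T by fact
  note rt = rooted_treeD[OF rt]
  have root: "(v, \<rho>) \<in> (parcs T)\<^sup>*" if "v \<in> pverts T" for v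
    using that
  proof (induct "dep v" arbitrary: v rule: less_induct)
    case less
    show ?case
    proof (cases "v = \<rho>")
      case False
      then have "(v, par v) \<in> parcs T" "dep (par v) < dep v" using rt less(2) by auto
      then show ?thesis using less(1) in_arcsD2 by (meson converse_rtrancl_into_rtrancl)
    qed simp
  qed
  have "sym ((parcs T)\<^sup>*)" by (rule sym_rtrancl) (auto simp: sym_def intro: arcs_symmetric)
  then have "conn_graph T"
    using root rt(1) pair_graph connected_pair_graph_iff[OF T]
    by (auto simp: conn_graph_def) (meson rtrancl_trans symD)
  moreover have False if c: "pre_digraph.cycle (with_proj T) c" "3 \<le> length c" for c
  proof -
    obtain u where u: "awalk u c u" "distinct (tl (awalk_verts u c))"
      using c(1) unfolding pre_digraph.cycle_def by auto
    define vs where "vs = awalk_verts u c"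
    define n where "n = length c"
    have n: "3 \<le> n" using c by (simp add: n_def)
    have len: "length vs = Suc n" using length_awalk_verts[of u c] by (simp add: vs_def n_def)
    have "hd vs = u" "last vs = u" using u(1) by (auto simp: vs_def)
    then have closed: "vs ! 0 = vs ! n" using len by (metis diff_Suc_1 hd_conv_nth last_conv_nth length_greater_0_conv zero_less_Suc)
    have "vwalk vs (with_proj T)" using awalk_imp_vwalk[OF u(1)] by (simp add: vs_def)
    then have arc: "(vs ! i, vs ! Suc i) \<in> parcs T" if "i < n" for i
      using vwalk_nth_arc[of vs "with_proj T" i] that len by simp
    have dist: "i = j" if "1 \<le> i" "i \<le> n" "1 \<le> j" "j \<le> n" "vs ! i = vs ! j" for i j
    proof -
      have "tl vs ! (i - 1) = vs ! i" "tl vs ! (j - 1) = vs ! j" using that len by (simp_all add: nth_tl)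
      then have "i - 1 = j - 1"
        using nth_eq_iff_index_eq[of "tl vs" "i - 1" "j - 1"] u(2) that len by (simp add: vs_def)
      then show ?thesis using that by simp
    qed
    define M where "M = Max ((\<lambda>i. dep (vs ! i)) ` {1..n})"
    have "M \<in> (\<lambda>i. dep (vs ! i)) ` {1..n}" unfolding M_def using n by (intro Max_in) auto
    then obtain i where i: "1 \<le> i" "i \<le> n" "dep (vs ! i) = M" by auto
    have le: "dep (vs ! j) \<le> dep (vs ! i)" if "1 \<le> j" "j \<le> n" for j
      unfolding i(3) M_def using that by (intro Max_ge) auto
    define p where "p = (if i = 1 then n else i - 1)"
    define q where "q = (if i = n then 1 else Suc i)"
    have p: "1 \<le> p" "p \<le> n" and q: "1 \<le> q" "q \<le> n" and "p \<noteq> q"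
      using i n by (auto simp: p_def q_def)
    have "(vs ! i, vs ! p) \<in> parcs T"
      using arc[of "i - 1"] i closed arcs_symmetric by (auto simp: p_def)
    moreover have "(vs ! i, vs ! q) \<in> parcs T"
      using arc[of i] arc[of 0] i n closed by (auto simp: q_def)
    moreover have "b = par a" if "(a, b) \<in> parcs T" "dep b \<le> dep a" for a b
      using rt(4)[OF that(1)] rt(3)[of b] that in_arcsD2 by fastforce
    ultimately have "vs ! p = vs ! q" using le p q by metis
    then show False using dist p q \<open>p \<noteq> q\<close> by blast
  qed
  ultimately show ?thesis by (auto simp: undirected_tree_def)
qed

lemma rtrancl_exit:
  assumes "(a, b) \<in> R\<^sup>*" "a \<in> D" "b \<notin> D"
  shows "\<exists>x y. (x, y) \<in> R \<and> x \<in> D \<and> y \<notin> D"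
  using assms by (induct rule: rtrancl_induct) auto

text \<open>The only edge that leaves the descendants of t is the one to its parent, so a connected set that
  contains t and another vertex of at most the same depth uses that edge.\<close>

lemma parent_in_connected:
  assumes rt: "rooted_tree T \<rho> par dep" and wf: "pair_wf_digraph T"
    and S: "(t, t') \<in> (parcs T \<inter> S \<times> S)\<^sup>*" and t: "t \<in> pverts T" "t' \<noteq> t" "dep t' \<le> dep t"
  shows "t \<noteq> \<rho> \<and> par t \<in> S"
proof -
  interpret pair_wf_digraph T by fact
  note rt = rooted_treeD[OF rt]
  define P where "P = {(v, par v) |v. v \<in> pverts T \<and> v \<noteq> \<rho>}"
  have "x = t \<or> dep t < dep x" if "(x, t) \<in> P\<^sup>*" for x
    using that
  proof (induct rule: converse_rtrancl_induct)
    case (step y z)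
    then have "dep y = Suc (dep z)" using rt(3) by (auto simp: P_def)
    then show ?case using step by auto
  qed simp
  then have "(t', t) \<notin> P\<^sup>*" using t by fastforce
  then obtain x y where xy: "(x, y) \<in> parcs T \<inter> S \<times> S" "(x, t) \<in> P\<^sup>*" "(y, t) \<notin> P\<^sup>*"
    using rtrancl_exit[OF S, of "{x. (x, t) \<in> P\<^sup>*}"] by auto
  have v: "x \<in> pverts T" "y \<in> pverts T" using xy(1) in_arcsD1 in_arcsD2 by auto
  have "\<not> (y \<noteq> \<rho> \<and> x = par y)"
    using xy v by (auto simp: P_def intro: converse_rtrancl_into_rtrancl)
  then have "x \<noteq> \<rho>" "y = par x" using rt(4) xy(1) by auto
  moreover have "x = t"
  proof (rule ccontr)
    assume "x \<noteq> t"
    then obtain z where "(x, z) \<in> P" "(z, t) \<in> P\<^sup>*" using xy(2) by (meson converse_rtranclE)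
    then show False using xy(3) calculation by (auto simp: P_def)
  qed
  ultimately show ?thesis using xy(1) by auto
qed

lemma tree_decompositionD:
  assumes "tree_decomposition G T B"
  shows "undirected_tree T" "(\<Union>t\<in>pverts T. B t) = pverts G"
    "\<And>u v. (u, v) \<in> parcs G \<Longrightarrow> \<exists>t\<in>pverts T. u \<in> B t \<and> v \<in> B t"
    "\<And>v. v \<in> pverts G \<Longrightarrow>
      Digraph_Component.connected (with_proj T \<restriction> {t \<in> pverts T. v \<in> B t})"
  using assms by (auto simp: tree_decomposition_def)

text \<open>Root the decomposition tree and let x be a vertex of C whose bags start deepest. A neighbour
  in C shares a bag with x and its bags start no deeper, so they pass through the bag where those
  of x start.\<close>

lemma tree_decomposition_degenerate:
  assumes td: "tree_decomposition G T B" and C: "finite C" "C \<noteq> {}" "C \<subseteq> pverts G"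
  shows "\<exists>x\<in>C. \<exists>t\<in>pverts T. x \<in> B t \<and> (\<forall>y\<in>C. (x, y) \<in> parcs G \<longrightarrow> y \<in> B t)"
proof -
  note tdD = tree_decompositionD[OF td]
  interpret T: connected_graph T using tdD(1) by unfold_locales (simp add: undirected_tree_def)
  obtain \<rho> par dep where rt: "rooted_tree T \<rho> par dep"
    using undirected_tree_rooted[OF tdD(1)] by blast
  note rtD = rooted_treeD[OF rt]
  define N where "N x = {t \<in> pverts T. x \<in> B t}" for x
  have symT: "sym (parcs T)" by (auto simp: sym_def intro: T.sym_arc)
  have path: "(t, t') \<in> (parcs T \<inter> N x \<times> N x)\<^sup>*" if "x \<in> C" "t \<in> N x" "t' \<in> N x" for x t t'
    using tdD(4)[of x] that C(3) unfolding connected_induced_iff[OF symT] N_def by blast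
  have "\<exists>t. t \<in> N x \<and> (\<forall>t'\<in>N x. dep t \<le> dep t')" if "x \<in> C" for x
  proof -
    have "N x \<noteq> {}" using tdD(2) that C(3) by (auto simp: N_def)
    then show ?thesis using ex_has_least_nat[of "\<lambda>t. t \<in> N x" _ dep] by blast
  qed
  then obtain top where top: "\<And>x. x \<in> C \<Longrightarrow> top x \<in> N x"
    "\<And>x t. x \<in> C \<Longrightarrow> t \<in> N x \<Longrightarrow> dep (top x) \<le> dep t" by metis
  obtain x where x: "x \<in> C" "\<And>y. y \<in> C \<Longrightarrow> dep (top y) \<le> dep (top x)"
  proof -
    have "Max ((\<lambda>y. dep (top y)) ` C) \<in> (\<lambda>y. dep (top y)) ` C" using C by (intro Max_in) auto
    then obtain x where "x \<in> C" "dep (top x) = Max ((\<lambda>y. dep (top y)) ` C)" by auto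
    then show thesis using C(1) by (intro that) auto
  qed
  have ascend: "top x \<in> N y" if y: "y \<in> C" and "t \<in> N x" "t \<in> N y" for y t
    using that(2,3)
  proof (induct "dep t" arbitrary: t rule: less_induct)
    case less
    have tv: "t \<in> pverts T" using less(2) by (simp add: N_def)
    show ?case
    proof (cases "t = top x")
      case False
      then have parx: "t \<noteq> \<rho>" "par t \<in> N x"
        using parent_in_connected[OF rt _ path[OF x(1) less(2) top(1)[OF x(1)]] tv]
          top(2)[OF x(1) less(2)] T.pair_wf_digraph by auto
      then have dep: "dep t = Suc (dep (par t))" using rtD(3) tv by blast
      have "t \<noteq> top y"
      proof
        assume "t = top y"
        then show False using x(2)[OF y] top(2)[OF x(1) parx(2)] dep by simp
      qed
      then have "par t \<in> N y"
        using parent_in_connected[OF rt _ path[OF y less(3) top(1)[OF y]] tv]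
          top(2)[OF y less(3)] T.pair_wf_digraph by auto
      then show ?thesis using less(1)[of "par t"] dep parx by simp
    qed (use less in simp)
  qed
  have "y \<in> B (top x)" if y: "y \<in> C" "(x, y) \<in> parcs G" for y
  proof -
    obtain t where "t \<in> N x" "t \<in> N y" using tdD(3)[OF y(2)] by (auto simp: N_def)
    then show ?thesis using ascend y by (auto simp: N_def)
  qed
  then show ?thesis using x(1) top(1)[OF x(1)] by (auto simp: N_def)
qed

lemma Max_card_bag:
  assumes "tree_decomposition G T B" "t \<in> pverts T"
  shows "card (B t) \<le> Max ((\<lambda>t. card (B t)) ` pverts T)"
proof -
  have "pair_graph T" using assms by (auto simp: tree_decomposition_def undirected_tree_def conn_graph_def)
  then have "finite (pverts T)"
    by (simp add: pair_graph_def pair_digraph_def pair_fin_digraph.pair_finite_verts)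
  then show ?thesis using assms(2) by simp
qed

lemma treewidth_le:
  fixes T :: "nat pair_pre_digraph"
  assumes "tree_decomposition G T B"
  shows "treewidth G \<le> decomposition_width T B"
  unfolding treewidth_def by (rule Least_le) (use assms in blast)

text \<open>A single bag containing all vertices shows that the minimum is over a non-empty set.\<close>

lemma treewidth_attained:
  assumes "pair_graph G"
  shows "\<exists>(T :: nat pair_pre_digraph) B. tree_decomposition G T B \<and>
    decomposition_width T B = treewidth G"
proof -
  define T :: "nat pair_pre_digraph" where "T = \<lparr>pverts = {0}, parcs = {}\<rparr>"
  have "pair_graph T" by unfold_locales (auto simp: T_def symmetric_def sym_def)
  moreover have "rooted_tree T 0 id (\<lambda>_. 0)" by (auto simp: rooted_tree_def T_def)
  ultimately have "undirected_tree T" by (rule rooted_undirected_tree)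
  moreover have "sym (parcs T)" by (auto simp: T_def sym_def)
  ultimately have "tree_decomposition G T (\<lambda>_. pverts G)"
    using assms unfolding tree_decomposition_def
    by (auto simp: T_def connected_induced_iff pair_graph_def pair_digraph_def pair_fin_digraph_def
        dest: pair_wf_digraph.in_arcsD1 pair_wf_digraph.in_arcsD2)
  then have "\<exists>w (T :: nat pair_pre_digraph) B. tree_decomposition G T B \<and> decomposition_width T B = w"
    by blast
  then show ?thesis unfolding treewidth_def by (rule LeastI_ex)
qed

text \<open>Once some bag has three vertices, subdividing an edge costs nothing: the ends of the edge
  and the new vertex form an additional leaf bag.\<close>

lemma tree_decomposition_subdivide:
  fixes T :: "nat pair_pre_digraph"
  assumes G: "pair_graph G" and td: "tree_decomposition G T B"
    and big: "3 \<le> Max ((\<lambda>t. card (B t)) ` pverts T)"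
    and e: "(u, v) \<in> parcs G" and z: "z \<notin> pverts G"
  shows "\<exists>(T' :: nat pair_pre_digraph) B'. tree_decomposition (subdivide G (u, v) z) T' B' \<and>
    Max ((\<lambda>t. card (B' t)) ` pverts T') = Max ((\<lambda>t. card (B t)) ` pverts T)"
proof -
  interpret G: pair_graph G by fact
  note tdD = tree_decompositionD[OF td]
  interpret T: connected_graph T using tdD(1) by unfold_locales (simp add: undirected_tree_def)
  obtain \<rho> par dep where rt: "rooted_tree T \<rho> par dep"
    using undirected_tree_rooted[OF tdD(1)] by blast
  note rtD = rooted_treeD[OF rt]
  obtain t where t: "t \<in> pverts T" "u \<in> B t" "v \<in> B t" using tdD(3)[OF e] by blast
  obtain n where n: "n \<notin> pverts T" using ex_new_if_finite[OF infinite_UNIV_nat T.pair_finite_verts] by blast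
  define T' where "T' = \<lparr>pverts = insert n (pverts T), parcs = parcs T \<union> {(t, n), (n, t)}\<rparr>"
  define B' where "B' = B(n := {u, v, z})"
  have narc: "(x, n) \<notin> parcs T" "(n, x) \<notin> parcs T" for x using n T.in_arcsD1 T.in_arcsD2 by blast+
  have "t \<noteq> n" using t n by auto
  have uv: "u \<in> pverts G" "v \<in> pverts G" using e G.in_arcsD1 G.in_arcsD2 by auto
  have pg: "pair_graph T'"
  proof
    show "symmetric (with_proj T')" using T.sym_arc by (auto simp: symmetric_def sym_def T'_def)
  qed (use T.pair_finite_verts T.pair_finite_arcs T.in_arcsD1 T.in_arcsD2 t \<open>t \<noteq> n\<close> T.no_loops' in
      \<open>auto simp: T'_def\<close>)
  have "rooted_tree T' \<rho> (par(n := t)) (dep(n := Suc (dep t)))"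
    unfolding rooted_tree_def
  proof (intro conjI ballI impI)
    show "\<rho> \<in> pverts T'" using rtD(1) by (simp add: T'_def)
    fix x assume "x \<in> pverts T'" "x \<noteq> \<rho>"
    then consider "x = n" | "x \<in> pverts T" "x \<noteq> n" "par x \<noteq> n" "x \<noteq> \<rho>"
      using rtD(2) narc n by (auto simp: T'_def)
    then show "(x, (par(n := t)) x) \<in> parcs T'"
      "(dep(n := Suc (dep t))) x = Suc ((dep(n := Suc (dep t))) ((par(n := t)) x))"
      using rtD(2,3) \<open>t \<noteq> n\<close> by (cases, auto simp: T'_def)+
  next
    fix p assume "p \<in> parcs T'"
    then show "case p of (x, y) \<Rightarrow> y \<noteq> \<rho> \<and> x = (par(n := t)) y \<or> x \<noteq> \<rho> \<and> y = (par(n := t)) x"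
    proof -
      obtain x y where p: "p = (x, y)" by fastforce
      have "n \<noteq> \<rho>" using rtD(1) n by auto
      consider "(x, y) \<in> parcs T" "x \<noteq> n" "y \<noteq> n" | "(x, y) = (t, n)" | "(x, y) = (n, t)"
        using \<open>p \<in> parcs T'\<close> narc unfolding p by (auto simp: T'_def)
      then show ?thesis
        unfolding p using rtD(4)[of x y] \<open>n \<noteq> \<rho>\<close> by cases auto
    qed
  qed
  then have tree: "undirected_tree T'" by (rule rooted_undirected_tree[OF pg])
  have symT: "sym (parcs T)" "sym (parcs T')"
    using T.sym_arc by (auto simp: sym_def T'_def)
  have conn: "Digraph_Component.connected (with_proj T' \<restriction> {a \<in> pverts T'. x \<in> B' a})"
    if x: "x \<in> pverts G \<union> {z}" for x
  proof (cases "x = z")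
    case True
    then have "{a \<in> pverts T'. x \<in> B' a} = {n}" using tdD(2) z by (auto simp: T'_def B'_def)
    then show ?thesis unfolding connected_induced_iff[OF symT(2)] by simp
  next
    case False
    define N where "N = {a \<in> pverts T. x \<in> B a}"
    have xG: "x \<in> pverts G" using x False by simp
    have N: "N \<noteq> {}" "\<And>a b. a \<in> N \<Longrightarrow> b \<in> N \<Longrightarrow> (a, b) \<in> (parcs T \<inter> N \<times> N)\<^sup>*"
      using tdD(4)[OF xG] unfolding connected_induced_iff[OF symT(1)] N_def by auto
    define N' where "N' = {a \<in> pverts T'. x \<in> B' a}"
    have N': "N' = N \<or> N' = insert n N \<and> t \<in> N"
      using n t False by (auto simp: N'_def N_def T'_def B'_def)
    have mono: "(a, b) \<in> (parcs T' \<inter> N' \<times> N')\<^sup>*" if "a \<in> N" "b \<in> N" for a b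
      by (rule subsetD[OF rtrancl_mono N(2)[OF that]]) (use N' in \<open>auto simp: T'_def\<close>)
    have "(a, b) \<in> (parcs T' \<inter> N' \<times> N')\<^sup>*" if "a \<in> N'" "b \<in> N'" for a b
    proof -
      have tn: "(t, n) \<in> parcs T' \<inter> N' \<times> N'" "(n, t) \<in> parcs T' \<inter> N' \<times> N'" "t \<in> N"
        if "n \<in> N'"
        using that N' n by (auto simp: T'_def N_def)
      have old: "a \<in> N \<or> a = n" "b \<in> N \<or> b = n" using N' that by auto
      consider "a = n" "b = n" | "a = n" "b \<in> N" | "a \<in> N" "b = n" | "a \<in> N" "b \<in> N"
        using old by blast
      then show ?thesis
      proof cases
        case 2
        then have "(t, b) \<in> (parcs T' \<inter> N' \<times> N')\<^sup>*" using mono tn(3) that by blast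
        then show ?thesis
          using tn(2) that(1) unfolding 2(1) by (blast intro: converse_rtrancl_into_rtrancl)
      next
        case 3
        then have "(a, t) \<in> (parcs T' \<inter> N' \<times> N')\<^sup>*" using mono tn(3) that by blast
        then show ?thesis
          using tn(1) that(2) unfolding 3(2) by (blast intro: rtrancl_into_rtrancl)
      qed (simp_all add: mono)
    qed
    moreover have "N' \<noteq> {}" using N(1) N' by auto
    ultimately show ?thesis
      unfolding N'_def[symmetric] connected_induced_iff[OF symT(2)] by simp
  qed
  have "tree_decomposition (subdivide G (u, v) z) T' B'"
    unfolding tree_decomposition_def
  proof (intro conjI tree)
    have "(\<Union>a\<in>pverts T'. B' a) = {u, v, z} \<union> (\<Union>a\<in>pverts T. B a)"
      using n by (auto simp: T'_def B'_def)
    then show "(\<Union>a\<in>pverts T'. B' a) = pverts (subdivide G (u, v) z)" using tdD(2) uv by auto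
    have "\<exists>a\<in>pverts T'. x \<in> B' a \<and> y \<in> B' a" if "(x, y) \<in> parcs (subdivide G (u, v) z)" for x y
    proof (cases "(x, y) \<in> parcs G")
      case True
      then show ?thesis using tdD(3) n by (fastforce simp: T'_def B'_def)
    next
      case False
      then show ?thesis using that by (auto simp: T'_def B'_def)
    qed
    then show "\<forall>(x, y)\<in>parcs (subdivide G (u, v) z). \<exists>a\<in>pverts T'. x \<in> B' a \<and> y \<in> B' a" by blast
    show "\<forall>x\<in>pverts (subdivide G (u, v) z).
        Digraph_Component.connected (with_proj T' \<restriction> {a \<in> pverts T'. x \<in> B' a})"
      using conn by simp
  qed
  moreover have "Max ((\<lambda>t. card (B' t)) ` pverts T') = Max ((\<lambda>t. card (B t)) ` pverts T)"
  proof -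
    have "(\<lambda>t. card (B' t)) ` pverts T' = insert (card {u, v, z}) ((\<lambda>t. card (B t)) ` pverts T)"
      using n by (auto simp: T'_def B'_def)
    moreover have "card {u, v, z} \<le> 3" by (simp add: card_insert_if)
    ultimately show ?thesis
      using big T.pair_finite_verts T.ex_vert by (simp add: max_absorb2)
  qed
  ultimately show ?thesis by blast
qed

lemma tree_decomposition_subdivision:
  fixes T :: "nat pair_pre_digraph"
  assumes "subdivision_pair G K" "pair_graph G" "tree_decomposition G T B"
    "3 \<le> Max ((\<lambda>t. card (B t)) ` pverts T)"
  shows "\<exists>(T' :: nat pair_pre_digraph) B'. tree_decomposition K T' B' \<and>
    Max ((\<lambda>t. card (B' t)) ` pverts T') = Max ((\<lambda>t. card (B t)) ` pverts T)"
  using assms(1)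
proof (induct rule: subdivision_pair_induct)
  case base
  then show ?case using assms by blast
next
  case (divide e z I)
  obtain u v where e: "e = (u, v)" by fastforce
  have "pair_graph I" using pair_graph.pair_graph_subdivision assms(2) divide by blast
  then show ?case
    using divide assms(4) tree_decomposition_subdivide[of I _ _ u v z] unfolding e by metis
qed

section \<open>Treewidth of subdivisions\<close>

text \<open>In a graph of treewidth at most one, every set of vertices contains one with at most one
  neighbour in the set, so removing such vertices one by one counts the edges.\<close>

lemma card_edges_width_one:
  assumes G: "pair_graph G" and td: "tree_decomposition G T B"
    and small: "\<And>t. t \<in> pverts T \<Longrightarrow> card (B t) \<le> 2"
    and E: "E \<subseteq> parcs G" "\<And>x y. (x, y) \<in> E \<Longrightarrow> (y, x) \<notin> E"
    and C: "C \<noteq> {}" "C \<subseteq> pverts G"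
  shows "card (E \<inter> C \<times> C) < card C"
proof -
  interpret pair_graph G by fact
  have fin: "finite C" if "C \<subseteq> pverts G" for C using that pair_finite_verts finite_subset by blast
  show ?thesis
    using C
  proof (induct "card C" arbitrary: C rule: less_induct)
    case less
    note finC = fin[OF less(3)]
    obtain x t where x: "x \<in> C" "t \<in> pverts T" "x \<in> B t"
      and nb: "\<And>y. y \<in> C \<Longrightarrow> (x, y) \<in> parcs G \<Longrightarrow> y \<in> B t"
      using tree_decomposition_degenerate[OF td finC less(2,3)] by blast
    define C' where "C' = C - {x}"
    have cC: "card C = Suc (card C')" using card_Suc_Diff1[OF finC x(1)] by (simp add: C'_def)
    have rest: "card (E \<inter> C' \<times> C') \<le> card C' - 1"
    proof (cases "C' = {}")
      case False
      moreover have "C' \<subseteq> pverts G" using less(3) by (auto simp: C'_def)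
      ultimately have "card (E \<inter> C' \<times> C') < card C'" using less(1)[of C'] cC by simp
      then show ?thesis by simp
    qed simp
    define I where "I = E \<inter> C \<times> C - C' \<times> C'"
    have B: "finite (B t)" using tree_decompositionD(2)[OF td] x(2) fin by blast
    have end1: "\<exists>y. e \<in> {(x, y), (y, x)} \<and> y \<in> B t - {x} \<and> y \<in> C'" if e: "e \<in> I" for e
    proof -
      obtain a b where ab: "e = (a, b)" by fastforce
      have e': "(a, b) \<in> parcs G" "a \<in> C" "b \<in> C" "a = x \<or> b = x" "a \<noteq> b"
        using e E(1) no_loops' by (auto simp: I_def C'_def ab)
      then show ?thesis
        using nb[of b] nb[of a] arcs_symmetric[OF e'(1)] by (auto simp: ab C'_def)
    qed
    have "card (B t - {x}) \<le> 1" using small[OF x(2)] x(3) B by simp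
    then have "\<forall>y\<in>B t - {x}. \<forall>z\<in>B t - {x}. y = z"
      unfolding One_nat_def by (subst (asm) card_le_Suc0_iff_eq) (use B in auto)
    then have same: "y = z" if "y \<in> B t - {x}" "z \<in> B t - {x}" for y z using that by blast
    have "e = e'" if "e \<in> I" "e' \<in> I" for e e'
    proof -
      obtain y y' where y: "e \<in> {(x, y), (y, x)}" "y \<in> B t - {x}"
        "e' \<in> {(x, y'), (y', x)}" "y' \<in> B t - {x}" using end1 \<open>e \<in> I\<close> \<open>e' \<in> I\<close> by meson
      have "y = y'" using same y by blast
      moreover have "e \<in> E" "e' \<in> E" using that by (auto simp: I_def)
      ultimately show ?thesis using y E(2)[of x y] by auto
    qed
    then have I: "finite I" "card I \<le> 1"
      using finC by (auto simp: I_def card_le_Suc0_iff_eq)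
    have "E \<inter> C \<times> C = (E \<inter> C' \<times> C') \<union> I" by (auto simp: I_def C'_def)
    then have "card (E \<inter> C \<times> C) \<le> card (E \<inter> C' \<times> C') + card I" using card_Un_le by metis
    moreover have "card I = 0" if "C' = {}" using end1 that I by auto
    moreover have "1 \<le> card C'" if "C' \<noteq> {}"
      using that finC by (simp add: C'_def Suc_le_eq card_gt_0_iff del: Diff_eq_empty_iff)
    ultimately show ?case
      using rest I(2) cC by (cases "C' = {}") auto
  qed
qed

text \<open>The edges from the nodes other than s to chosen parents already number one less than the nodes,
  so a second parent would give too many edges.\<close>

lemma (in layered_graph) unique_parent_width_one:
  assumes td: "tree_decomposition H T B" and small: "\<And>t. t \<in> pverts T \<Longrightarrow> card (B t) \<le> 2"
    and gh: "(g, h) \<in> up s" "(g', h) \<in> up s"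
  shows "g = g'"
proof (rule ccontr)
  assume "g \<noteq> g'"
  have "\<exists>p. \<forall>x\<in>pverts H - {s}. (p x, x) \<in> up s"
    using ex_lower[OF root] by (metis DiffE singletonI)
  then obtain p where p: "\<And>x. x \<in> pverts H - {s} \<Longrightarrow> (p x, x) \<in> up s" by blast
  define e where "e = (if p h = g then g' else g)"
  have e: "(e, h) \<in> up s" "e \<noteq> p h" using gh \<open>g \<noteq> g'\<close> by (auto simp: e_def)
  have hs: "h \<noteq> s" using upD(5)[OF gh(1)] root by auto
  define X where "X = (\<lambda>x. (p x, x)) ` (pverts H - {s})"
  have "(p x, x) \<in> up s \<inter> pverts H \<times> pverts H" if "x \<in> pverts H - {s}" for x
    using p[OF that] upD(2,3)[OF p[OF that]] by simp
  then have "insert (e, h) X \<subseteq> up s \<inter> pverts H \<times> pverts H"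
    using e(1) upD(2,3)[OF e(1)] unfolding X_def by blast
  then have "card (insert (e, h) X) \<le> card (up s \<inter> pverts H \<times> pverts H)"
    using finite_up by (intro card_mono) auto
  also have "\<dots> < card (pverts H)"
    by (rule card_edges_width_one[OF pair_graph td small]) (auto simp: up_def intro: root)
  finally have "card (insert (e, h) X) < card (pverts H)" .
  moreover have "(e, h) \<notin> X" using e by (auto simp: X_def)
  moreover have "card X = card (pverts H - {s})"
    unfolding X_def by (rule card_image) (auto intro: inj_onI)
  moreover have "finite X" using pair_finite_verts by (simp add: X_def)
  ultimately show False using root pair_finite_verts by (simp add: card_Diff_singleton_if)
qed

context coded_layered_graph
begin

lemma tree_decomposition_copy:
  assumes td: "tree_decomposition H T B"
  shows "tree_decomposition copy T (\<lambda>t. node_pt ` B t)"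
    and "t \<in> pverts T \<Longrightarrow> card (node_pt ` B t) = card (B t)"
proof -
  note tdD = tree_decompositionD[OF td]
  have B: "B t \<subseteq> pverts H" if "t \<in> pverts T" for t using tdD(2) that by blast
  show "card (node_pt ` B t) = card (B t)" if "t \<in> pverts T" for t
    using B[OF that] by (intro card_image inj_onI) (auto simp: subset_iff)
  have bags: "{t \<in> pverts T. node_pt v \<in> node_pt ` B t} = {t \<in> pverts T. v \<in> B t}" if "v \<in> pverts H" for v
    using that B by (auto simp: subset_iff image_iff)
  have "(\<Union>t\<in>pverts T. node_pt ` B t) = pverts copy"
    unfolding pverts_copy using tdD(2) by blast
  moreover have "\<exists>t\<in>pverts T. x \<in> node_pt ` B t \<and> y \<in> node_pt ` B t" if "(x, y) \<in> parcs copy" for x y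
    using that tdD(3) unfolding parcs_copy by fastforce
  ultimately show "tree_decomposition copy T (\<lambda>t. node_pt ` B t)"
    unfolding tree_decomposition_def using tdD(1,4) bags by (auto simp: pverts_copy)
qed

end

context graded_subdivision
begin

lemma lower_neighbour_unique:
  assumes uniq: "\<And>g g' h. (g, h) \<in> up s \<Longrightarrow> (g', h) \<in> up s \<Longrightarrow> g = g'"
    and a: "(a, z) \<in> parcs K" "elevation z = Suc (elevation a)" and b: "(b, z) \<in> parcs K" "elevation z = Suc (elevation b)"
  shows "a = b"
proof -
  have up: "\<exists>g h i. (g, h) \<in> up s \<and> i < w g h \<and> x = edge_pt w g h i \<and> z = edge_pt w g h (Suc i)"
    if x: "(x, z) \<in> parcs K" "elevation z = Suc (elevation x)" for x
    using x(1)
  proof (rule parcs_subE)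
    fix g h i
    assume "(g, h) \<in> up s" "i < w g h"
      "x = edge_pt w g h i \<and> z = edge_pt w g h (Suc i) \<or> x = edge_pt w g h (Suc i) \<and> z = edge_pt w g h i"
    then show ?thesis using x(2) by (auto simp: ht_pt)
  qed
  obtain g h i where g: "(g, h) \<in> up s" "i < w g h" "a = edge_pt w g h i" "z = edge_pt w g h (Suc i)"
    using up[OF a] by blast
  obtain g' h' j where g': "(g', h') \<in> up s" "j < w g' h'" "b = edge_pt w g' h' j" "z = edge_pt w g' h' (Suc j)"
    using up[OF b] by blast
  have "decode z = (if Suc i = w g h then (h, h, 0) else (g, h, Suc i))"
    using decode_pt[OF g(1), of w "Suc i"] g(4) by simp
  moreover have "decode z = (if Suc j = w g' h' then (h', h', 0) else (g', h', Suc j))"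
    using decode_pt[OF g'(1), of w "Suc j"] g'(4) by simp
  ultimately have eq: "(if Suc i = w g h then (h, h, 0) else (g, h, Suc i)) =
      (if Suc j = w g' h' then (h', h', 0) else (g', h', Suc j))" by simp
  have "h = h' \<and> (g = g' \<longrightarrow> i = j)"
  proof (cases "Suc i = w g h")
    case True
    then have "Suc j = w g' h'" using eq by (metis Pair_inject Zero_not_Suc)
    then have "h = h'" using eq True by simp
    then show ?thesis using True \<open>Suc j = w g' h'\<close> by (metis nat.inject)
  next
    case False
    then have "Suc j \<noteq> w g' h'" using eq by (metis Pair_inject Zero_not_Suc)
    then show ?thesis using eq False by simp
  qed
  then have h: "h = h'" "g = g' \<Longrightarrow> i = j" by blast+
  moreover have "g = g'" by (rule uniq[OF g(1)]) (use g'(1) h(1) in simp)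
  ultimately show ?thesis using h g(3) g'(3) by simp
qed

text \<open>If every node has only one parent then the subdivision is itself a tree, and each vertex
  together with its parent makes a bag.\<close>

lemma treewidth_tree:
  assumes uniq: "\<And>g g' h. (g, h) \<in> up s \<Longrightarrow> (g', h) \<in> up s \<Longrightarrow> g = g'"
  shows "treewidth K \<le> 1" "up s = {} \<Longrightarrow> treewidth K = 0"
proof -
  have \<rho>: "node_pt s \<in> pverts K" using root by simp
  obtain par where par: "\<And>z. z \<in> pverts K \<Longrightarrow> z \<noteq> node_pt s \<Longrightarrow> (par z, z) \<in> K.up (node_pt s)"
    using K.ex_lower[OF \<rho>] by metis
  have parD: "(par z, z) \<in> parcs K" "elevation z = Suc (elevation (par z))" "par z \<in> pverts K"
    if "z \<in> pverts K" "z \<noteq> node_pt s" for z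
    using par[OF that] root_dist that K.in_arcsD1[of "par z" z] by (auto simp: K.up_def)
  have toward: "y \<noteq> node_pt s \<and> x = par y" if "(x, y) \<in> parcs K" "elevation y = Suc (elevation x)" for x y
  proof -
    have "y \<in> pverts K" using that K.in_arcsD2 by blast
    moreover have "y \<noteq> node_pt s" using that(2) root grade_root by auto
    moreover have "x = par y"
    proof (rule lower_neighbour_unique)
      show "g = g'" if "(g, h) \<in> up s" "(g', h) \<in> up s" for g g' h using uniq that .
    qed (use that parD calculation in auto)
    ultimately show ?thesis by blast
  qed
  have "rooted_tree K (node_pt s) par elevation"
    unfolding rooted_tree_def
  proof (intro conjI ballI impI)
    fix e assume "e \<in> parcs K"
    moreover obtain x y where "e = (x, y)" by fastforce
    ultimately show "case e of (x, y) \<Rightarrow> y \<noteq> node_pt s \<and> x = par y \<or> x \<noteq> node_pt s \<and> y = par x"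
      using arc_ht[of x y] toward[of x y] toward[of y x] K.sym_arc[of x y] by auto
  qed (use \<rho> parD K.sym_arc in auto)
  then have tree: "undirected_tree K" by (rule rooted_undirected_tree[OF K.pair_graph])
  define B where "B z = (if z = node_pt s then {z} else {z, par z})" for z
  have symK: "sym (parcs K)" using K.sym_arc by (auto simp: sym_def)
  have star: "Digraph_Component.connected (with_proj K \<restriction> {z \<in> pverts K. x \<in> B z})"
    if x: "x \<in> pverts K" for x
  proof -
    define N where "N = {z \<in> pverts K. x \<in> B z}"
    have xN: "x \<in> N" using x by (simp add: N_def B_def)
    have "(z, x) \<in> parcs K \<and> (x, z) \<in> parcs K" if "z \<in> N" "z \<noteq> x" for z
      using that parD[of z] K.sym_arc by (auto simp: N_def B_def split: if_splits)
    then have "(z, x) \<in> (parcs K \<inter> N \<times> N)\<^sup>*" "(x, z) \<in> (parcs K \<inter> N \<times> N)\<^sup>*" if "z \<in> N" for z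
      using that xN by (cases "z = x"; blast)+
    then show ?thesis
      unfolding N_def[symmetric] connected_induced_iff[OF symK] using xN
      by (meson empty_iff rtrancl_trans)
  qed
  have cover: "\<exists>z\<in>pverts K. x \<in> B z \<and> y \<in> B z" if "(x, y) \<in> parcs K" for x y
    using arc_ht[OF that] toward[OF that] toward[OF K.sym_arc[OF that]]
      K.in_arcsD1[OF that] K.in_arcsD2[OF that] by (auto simp: B_def)
  have "(\<Union>z\<in>pverts K. B z) = pverts K" using parD by (auto simp: B_def)
  then have td: "tree_decomposition K K B"
    unfolding tree_decomposition_def using tree cover star by auto
  have "card (B z) \<le> Suc (Suc 0)" for z by (simp add: B_def card_insert_if)
  then have "decomposition_width K B \<le> 1"
    unfolding decomposition_width_def
    using K.pair_finite_verts K.ex_vert by (simp add: le_diff_conv)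
  then show "treewidth K \<le> 1" using treewidth_le[OF td] by simp
  assume no_up: "up s = {}"
  then have "pverts H = {s}"
    using ex_lower[OF root] root by auto
  then have "pverts K = {node_pt s}" using no_up by (auto simp: pverts_sub)
  then have "decomposition_width K B = 0" by (simp add: decomposition_width_def B_def)
  then show "treewidth K = 0" using treewidth_le[OF td] by simp
qed

text \<open>Leaf bags of three vertices are too large when H has treewidth at most one. In that case the
  subdivision is decomposed as a tree instead.\<close>

lemma treewidth_sub_le: "treewidth K \<le> treewidth H"
proof -
  obtain T :: "nat pair_pre_digraph" and B where td: "tree_decomposition H T B"
    and width: "decomposition_width T B = treewidth H"
    using treewidth_attained[OF pair_graph] by blast
  note copy = tree_decomposition_copy[OF td]
  define m where "m = Max ((\<lambda>t. card (B t)) ` pverts T)"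
  have m: "treewidth H = m - 1" using width by (simp add: decomposition_width_def m_def)
  have bag: "card (B t) \<le> m" if "t \<in> pverts T" for t
    using Max_card_bag[OF td that] by (simp add: m_def)
  show ?thesis
  proof (cases "3 \<le> m")
    case True
    have m': "Max ((\<lambda>t. card (node_pt ` B t)) ` pverts T) = m"
      unfolding m_def using copy(2) by (metis (no_types, lifting) image_cong)
    then obtain T' :: "nat pair_pre_digraph" and B' where "tree_decomposition K T' B'"
      "Max ((\<lambda>t. card (B' t)) ` pverts T') = m"
      using tree_decomposition_subdivision[OF subdivision_pair_sub[OF pos] pair_graph_copy copy(1)]
        True by auto
    then show ?thesis using treewidth_le[of K T' B'] m by (simp add: decomposition_width_def)
  next
    case False
    then have "card (B t) \<le> 2" if "t \<in> pverts T" for t using bag[OF that] by simp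
    then have uniq: "g = g'" if "(g, h) \<in> up s" "(g', h) \<in> up s" for g g' h
      using unique_parent_width_one[OF td] that by blast
    show ?thesis
    proof (cases "up s = {}")
      case False
      then obtain g h where gh: "(g, h) \<in> up s" by auto
      then obtain t where t: "t \<in> pverts T" "g \<in> B t" "h \<in> B t"
        using tree_decompositionD(3)[OF td upD(1)[OF gh]] by blast
      have "B t \<subseteq> pverts H" using tree_decompositionD(2)[OF td] t(1) by blast
      then have "card {g, h} \<le> card (B t)"
        using t finite_subset[OF _ pair_finite_verts] by (intro card_mono) auto
      then have "2 \<le> m" using bag[OF t(1)] upD(4)[OF gh] by simp
      moreover have "treewidth K \<le> 1" by (rule treewidth_tree(1)) (rule uniq)
      ultimately show ?thesis using m by simp
    next
      case True
      have "treewidth K = 0" by (rule treewidth_tree(2)[OF _ True]) (rule uniq)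
      then show ?thesis by simp
    qed
  qed
qed

end

section \<open>Distances from the root of a nicely rooted partition\<close>

lemma INF_le_enat_iff: "(INF u\<in>U. f u) \<le> enat n \<longleftrightarrow> (\<exists>u\<in>U. f u \<le> enat n)"
proof
  assume le: "(INF u\<in>U. f u) \<le> enat n"
  then have "f ` U \<noteq> {}" by (auto simp: top_enat_def)
  then have "Inf (f ` U) \<in> f ` U" by (metis wellorder_InfI ex_in_conv)
  then show "\<exists>u\<in>U. f u \<le> enat n" using le by auto
next
  assume "\<exists>u\<in>U. f u \<le> enat n"
  then show "(INF u\<in>U. f u) \<le> enat n" by (auto intro: INF_lower2)
qed

lemma relpow_subset: "(A :: 'a rel) \<subseteq> B \<Longrightarrow> A ^^ n \<subseteq> B ^^ n"
  by (induct n) auto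

text \<open>Names for the parts of the definition of a nicely rooted partition, with natural numbers in
  place of extended ones wherever the values are finite.\<close>

locale rooted_partition = G: connected_graph G + H: layered_graph H s
  for G :: "'v pair_pre_digraph" and H :: "'h pair_pre_digraph" and s +
  fixes V :: "'h \<Rightarrow> 'v set" and R :: nat
  assumes part: "graph_partition G H V" and hon: "honest G H V"
    and bdd: "bounded_partition R G H V" and nice: "nicely_rooted R G H V s"
begin

lemma V_sub: "h \<in> pverts H \<Longrightarrow> V h \<subseteq> pverts G"
  using part by (auto simp: graph_partition_def)

lemma V_disjoint: "g \<in> pverts H \<Longrightarrow> h \<in> pverts H \<Longrightarrow> x \<in> V g \<Longrightarrow> x \<in> V h \<Longrightarrow> g = h"
  using part by (auto simp: graph_partition_def disjoint_family_on_def)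

lemma V_nonempty: "h \<in> pverts H \<Longrightarrow> V h \<noteq> {}"
  using hon by (auto simp: honest_def)

definition node :: "'v \<Rightarrow> 'h" where "node x = (SOME h. h \<in> pverts H \<and> x \<in> V h)"

lemma node_in: "x \<in> pverts G \<Longrightarrow> node x \<in> pverts H" "x \<in> pverts G \<Longrightarrow> x \<in> V (node x)"
proof -
  assume "x \<in> pverts G"
  then have "\<exists>h. h \<in> pverts H \<and> x \<in> V h" using part by (auto simp: graph_partition_def)
  then have "node x \<in> pverts H \<and> x \<in> V (node x)" unfolding node_def by (rule someI_ex)
  then show "node x \<in> pverts H" "x \<in> V (node x)" by auto
qed

lemma node_eq: "h \<in> pverts H \<Longrightarrow> x \<in> V h \<Longrightarrow> node x = h"
  using V_sub node_in V_disjoint by blast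

lemma arc_node:
  assumes "(x, y) \<in> parcs G"
  shows "node x = node y \<or> (node x, node y) \<in> H.up s \<or> (node y, node x) \<in> H.up s"
proof -
  have "x \<in> pverts G" "y \<in> pverts G" using assms G.in_arcsD1 G.in_arcsD2 by auto
  then have "node x = node y \<or> (node x, node y) \<in> parcs H"
    using part assms node_in unfolding graph_partition_def by blast
  then show ?thesis using H.up_or_down by blast
qed

lemma arc_between:
  assumes "(g, h) \<in> parcs H"
  obtains x y where "x \<in> V g" "y \<in> V h" "(x, y) \<in> parcs G"
  using hon assms by (auto simp: honest_def)

lemma dist_in_part:
  assumes "h \<in> pverts H" "x \<in> V h" "y \<in> V h"
  shows "G.d x y \<le> R"
proof -
  have "gdist (with_proj G) x y \<le> enat R" using bdd assms unfolding bounded_partition_def by blast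
  moreover have "x \<in> pverts G" "y \<in> pverts G" using V_sub assms by auto
  ultimately show ?thesis using G.gdist_eq by simp
qed

lemma lower_verts_eq: "lower_verts H V s n = {x \<in> pverts G. H.d s (node x) \<le> n}"
proof -
  have "h \<in> layer H s i \<longleftrightarrow> h \<in> pverts H \<and> H.d s h = i" for h i
    using H.gdist_eq[OF H.root, of h] by (auto simp: layer_def)
  then have "x \<in> lower_verts H V s n \<longleftrightarrow> (\<exists>h\<in>pverts H. H.d s h \<le> n \<and> x \<in> V h)" for x
    unfolding lower_verts_def by auto
  moreover have "(\<exists>h\<in>pverts H. H.d s h \<le> n \<and> x \<in> V h) \<longleftrightarrow>
      x \<in> pverts G \<and> H.d s (node x) \<le> n" for x
    using V_sub[of "node x"] node_in[of x] node_eq[of _ x] V_sub by (metis subsetD)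
  ultimately show ?thesis by blast
qed

definition upper_verts :: "'h \<Rightarrow> 'v set" where
  "upper_verts h = {x \<in> pverts G. H.d s h \<le> H.d s (node x)}"

definition upper_arcs :: "'h \<Rightarrow> 'v rel" where
  "upper_arcs h = parcs G \<inter> upper_verts h \<times> upper_verts h"

lemma layer_pos: "h \<in> pverts H \<Longrightarrow> h \<noteq> s \<Longrightarrow> 1 \<le> H.d s h"
  using H.d_zeroD[of s h] H.root by (cases "H.d s h") auto

lemma upper_verts_eq:
  assumes "h \<in> pverts H" "h \<noteq> s"
  shows "pverts G - lower_verts H V s (H.d s h - 1) = upper_verts h"
  unfolding lower_verts_eq upper_verts_def using layer_pos[OF assms] by auto

lemma nice_root_ball: "\<exists>r\<in>V s. \<exists>R\<^sub>s\<le>R. V s = graph_ball (with_proj G) {r} (enat R\<^sub>s)"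
  and nice_level: "\<forall>h\<in>pverts H - {s}. level_part G H V s h"
  and nice_cluster: "\<forall>S. cluster H s S \<longrightarrow> (\<forall>g\<in>S. \<forall>h\<in>S. height G H V s g = height G H V s h)"
  by (fact nice[unfolded nicely_rooted_def, THEN conjunct2, THEN conjunct2, THEN conjunct1]
      nice[unfolded nicely_rooted_def, THEN conjunct2, THEN conjunct2, THEN conjunct2, THEN conjunct1]
      nice[unfolded nicely_rooted_def, THEN conjunct2, THEN conjunct2, THEN conjunct2, THEN conjunct2])+

definition centre :: 'v where
  "centre = (SOME r. r \<in> V s \<and> (\<exists>R\<^sub>s\<le>R. V s = graph_ball (with_proj G) {r} (enat R\<^sub>s)))"

definition root_radius :: nat where
  "root_radius = (SOME R\<^sub>s. R\<^sub>s \<le> R \<and> V s = graph_ball (with_proj G) {centre} (enat R\<^sub>s))"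

lemma centre_props:
  "centre \<in> V s" "root_radius \<le> R" "V s = graph_ball (with_proj G) {centre} (enat root_radius)"
proof -
  have "\<exists>r. r \<in> V s \<and> (\<exists>R\<^sub>s\<le>R. V s = graph_ball (with_proj G) {r} (enat R\<^sub>s))"
    using nice_root_ball by (simp only: Bex_def)
  then have *: "centre \<in> V s \<and> (\<exists>R\<^sub>s\<le>R. V s = graph_ball (with_proj G) {centre} (enat R\<^sub>s))"
    unfolding centre_def by (rule someI_ex)
  then have "root_radius \<le> R \<and> V s = graph_ball (with_proj G) {centre} (enat root_radius)"
    unfolding root_radius_def by (intro someI_ex[OF *[THEN conjunct2]])
  then show "centre \<in> V s" "root_radius \<le> R"
    "V s = graph_ball (with_proj G) {centre} (enat root_radius)" using * by auto
qed

text \<open>The root part is treated like the others: the centre of the ball plays the role of its lower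
  boundary.\<close>

definition bottom :: "'h \<Rightarrow> 'v set" where
  "bottom h = (if h = s then {centre} else down_boundary G H V s h)"

definition rad :: "'h \<Rightarrow> nat" where
  "rad h = (if h = s then root_radius else the_enat (height G H V s h))"

lemma centre_vert: "centre \<in> pverts G"
  using centre_props(1) V_sub H.root by blast

lemma bottom_iff:
  assumes "h \<in> pverts H" "h \<noteq> s"
  shows "v \<in> bottom h \<longleftrightarrow> v \<in> V h \<and> (\<exists>u. (v, u) \<in> parcs G \<and> (node u, h) \<in> H.up s)"
proof -
  have "(u \<in> pverts G \<and> H.d s (node u) \<le> H.d s h - 1) \<longleftrightarrow> (node u, h) \<in> H.up s"
    if v: "v \<in> V h" and u: "(v, u) \<in> parcs G" for u
  proof
    assume "u \<in> pverts G \<and> H.d s (node u) \<le> H.d s h - 1"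
    then have "H.d s (node u) < H.d s h" using layer_pos[OF assms] by auto
    then show "(node u, h) \<in> H.up s"
      using arc_node[OF u] node_eq[OF assms(1) v] by (auto simp: H.up_def)
  next
    assume "(node u, h) \<in> H.up s"
    then show "u \<in> pverts G \<and> H.d s (node u) \<le> H.d s h - 1"
      using G.in_arcsD2[OF u] by (auto simp: H.up_def)
  qed
  then show ?thesis
    using assms(2) by (auto simp: bottom_def down_boundary_def lower_verts_eq)
qed

lemma bottom_sub: "h \<in> pverts H \<Longrightarrow> bottom h \<subseteq> V h"
  using centre_props(1) by (cases "h = s") (auto simp: bottom_iff, simp add: bottom_def)

lemma bottom_of_arc:
  assumes "(x, y) \<in> parcs G" "(node x, node y) \<in> H.up s"
  shows "y \<in> bottom (node y)"
proof -
  have "node y \<noteq> s" using H.upD(5)[OF assms(2)] H.root by auto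
  then show ?thesis
    using assms H.upD(3)[OF assms(2)] G.sym_arc[OF assms(1)] node_in(2) G.in_arcsD2[OF assms(1)]
    by (auto simp: bottom_iff)
qed

lemma bottom_nonempty:
  assumes "h \<in> pverts H"
  shows "bottom h \<noteq> {}"
proof (cases "h = s")
  case False
  then obtain g where gh: "(g, h) \<in> H.up s" using H.ex_lower[OF H.root assms] by blast
  obtain x y where "x \<in> V g" "y \<in> V h" "(x, y) \<in> parcs G" using arc_between H.upD(1)[OF gh] by blast
  then show ?thesis using bottom_of_arc node_eq H.upD[OF gh] gh by (metis empty_iff)
qed (simp add: bottom_def)

lemma height_eq:
  assumes h: "h \<in> pverts H" "h \<noteq> s"
  shows "height G H V s h = enat (rad h)" "rad h \<le> R"
proof -
  have "set_dist (with_proj G) (down_boundary G H V s h) v \<le> enat R" if v: "v \<in> V h" for v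
  proof -
    obtain u where u: "u \<in> bottom h" using bottom_nonempty[OF h(1)] by blast
    then have "gdist (with_proj G) u v \<le> enat R"
      using bdd h v bottom_sub[OF h(1)] by (auto simp: bounded_partition_def)
    then show ?thesis
      unfolding set_dist_def INF_le_enat_iff using u h by (auto simp: bottom_def)
  qed
  then have "height G H V s h \<le> enat R" unfolding height_def by (rule SUP_least)
  then show "height G H V s h = enat (rad h)" "rad h \<le> R"
    using h(2) by (cases "height G H V s h"; simp add: rad_def)+
qed

lemma rad_le: "h \<in> pverts H \<Longrightarrow> rad h \<le> R"
  using height_eq(2)[of h] centre_props(2) by (cases "h = s") (auto simp: rad_def)

text \<open>Every part, the root part included, is the ball of radius \<open>rad h\<close> around its bottom in the graph
  induced by the layers from its own on.\<close>

lemma part_eq_ball: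
  assumes h: "h \<in> pverts H"
  shows "v \<in> V h \<longleftrightarrow> (\<exists>u\<in>bottom h. \<exists>m\<le>rad h. (u, v) \<in> upper_arcs h ^^ m)"
proof (cases "h = s")
  case True
  have "upper_arcs s = parcs G"
    using H.root G.in_arcsD1 G.in_arcsD2 by (auto simp: upper_arcs_def upper_verts_def)
  moreover have "v \<in> pverts G" if "(centre, v) \<in> parcs G ^^ m" for m
    using G.relpow_verts[OF that centre_vert] .
  ultimately show ?thesis
    unfolding True using gdist_le_iff[OF G.wf, of centre v root_radius] centre_vert
    by (subst centre_props(3)) (auto simp: graph_ball_def set_dist_def bottom_def rad_def)
next
  case False
  let ?W = "upper_verts h" let ?I = "with_proj G \<restriction> upper_verts h"
  have wf: "wf_digraph ?I" by (rule G.wellformed_induce_subgraph)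
  have ends: "arcs_ends ?I = upper_arcs h" by (auto simp: arcs_ends_conv upper_arcs_def)
  have bot: "bottom h \<subseteq> ?W"
    using bottom_sub[OF h] V_sub[OF h] node_eq[OF h] by (auto simp: upper_verts_def)
  have inW: "v \<in> ?W" if "u \<in> bottom h" "(u, v) \<in> upper_arcs h ^^ m" for u m
    using that bot by (cases m) (auto simp: upper_arcs_def)
  have "V h = graph_ball ?I (bottom h) (enat (rad h))"
    using nice_level h False height_eq(1)[OF h False] upper_verts_eq[OF h False]
    unfolding level_part_def bottom_def by simp
  then have "v \<in> V h \<longleftrightarrow> v \<in> ?W \<and> (\<exists>u\<in>bottom h. gdist ?I u v \<le> enat (rad h))"
    by (simp add: graph_ball_def set_dist_def INF_le_enat_iff)
  also have "\<dots> \<longleftrightarrow> (\<exists>u\<in>bottom h. \<exists>m\<le>rad h. (u, v) \<in> upper_arcs h ^^ m)"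
    using gdist_le_iff[OF wf, unfolded ends] bot inW by (auto simp: subset_iff)
  finally show ?thesis .
qed

text \<open>The distance from the bottom of the part of v inside the upper graph.\<close>

definition depth_in :: "'v \<Rightarrow> nat" where
  "depth_in v = (LEAST m. \<exists>u\<in>bottom (node v). (u, v) \<in> upper_arcs (node v) ^^ m)"

lemma depth_in_le:
  "u \<in> bottom (node v) \<Longrightarrow> (u, v) \<in> upper_arcs (node v) ^^ m \<Longrightarrow> depth_in v \<le> m"
  unfolding depth_in_def by (rule Least_le) blast

lemma depth_in_props:
  assumes "v \<in> pverts G"
  shows "\<exists>u\<in>bottom (node v). (u, v) \<in> upper_arcs (node v) ^^ depth_in v"
    and "depth_in v \<le> rad (node v)"
proof -
  obtain u m where um: "u \<in> bottom (node v)" "m \<le> rad (node v)" "(u, v) \<in> upper_arcs (node v) ^^ m"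
    using part_eq_ball[OF node_in(1)[OF assms], of v] node_in(2)[OF assms] by blast
  then show "\<exists>u\<in>bottom (node v). (u, v) \<in> upper_arcs (node v) ^^ depth_in v"
    unfolding depth_in_def
    using LeastI[of "\<lambda>m. \<exists>u\<in>bottom (node v). (u, v) \<in> upper_arcs (node v) ^^ m" m] by blast
  show "depth_in v \<le> rad (node v)" using depth_in_le um by (meson order_trans)
qed

lemma depth_in_bottom: "v \<in> bottom (node v) \<Longrightarrow> depth_in v = 0"
  using depth_in_le[of v v 0] by simp

lemma depth_in_arc:
  assumes "(x, y) \<in> parcs G" "node x = node y"
  shows "depth_in y \<le> Suc (depth_in x)"
proof -
  have v: "x \<in> pverts G" "y \<in> pverts G" using assms G.in_arcsD1 G.in_arcsD2 by auto
  obtain u where "u \<in> bottom (node y)" "(u, x) \<in> upper_arcs (node y) ^^ depth_in x"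
    using depth_in_props(1)[OF v(1)] assms(2) by auto
  moreover have "(x, y) \<in> upper_arcs (node y)"
    using assms v by (auto simp: upper_arcs_def upper_verts_def)
  ultimately show ?thesis by (intro depth_in_le) auto
qed

text \<open>A vertex with a neighbour in a higher part sits at the very top of its own part: otherwise
  that neighbour would belong to the same ball.\<close>

lemma depth_in_exit:
  assumes xy: "(x, y) \<in> parcs G" and up: "(node x, node y) \<in> H.up s"
  shows "depth_in x = rad (node x)"
proof (rule ccontr)
  assume "depth_in x \<noteq> rad (node x)"
  have v: "x \<in> pverts G" "y \<in> pverts G" using xy G.in_arcsD1 G.in_arcsD2 by auto
  then have lt: "Suc (depth_in x) \<le> rad (node x)"
    using depth_in_props(2)[OF v(1)] \<open>depth_in x \<noteq> rad (node x)\<close> by simp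
  obtain u where u: "u \<in> bottom (node x)" "(u, x) \<in> upper_arcs (node x) ^^ depth_in x"
    using depth_in_props(1)[OF v(1)] by blast
  have "(x, y) \<in> upper_arcs (node x)"
    using xy v H.upD(5)[OF up] by (auto simp: upper_arcs_def upper_verts_def)
  then have "(u, y) \<in> upper_arcs (node x) ^^ Suc (depth_in x)" using u(2) by auto
  then have "y \<in> V (node x)"
    using part_eq_ball[OF node_in(1)[OF v(1)], of y] u(1) lt by blast
  then show False using node_eq[OF node_in(1)[OF v(1)]] H.upD(4)[OF up] by auto
qed

text \<open>Adjacency in H without the first j layers. Its reflexive transitive closure, restricted to layer
  j > 0, is the relation of lying in a common cluster.\<close>

definition above :: "nat \<Rightarrow> 'h rel" where
  "above j = parcs H \<inter> {h \<in> pverts H. j \<le> H.d s h} \<times> {h \<in> pverts H. j \<le> H.d s h}"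

lemma above_sym: "(g, h) \<in> (above j)\<^sup>* \<Longrightarrow> (h, g) \<in> (above j)\<^sup>*"
proof -
  have "sym ((above j)\<^sup>*)" by (rule sym_rtrancl) (auto simp: above_def sym_def intro: H.sym_arc)
  then show "(g, h) \<in> (above j)\<^sup>* \<Longrightarrow> (h, g) \<in> (above j)\<^sup>*" by (rule symD)
qed

text \<open>Two nodes of a layer that are connected above the previous layers lie in a common cluster,
  because a cluster candidate containing both extends to a maximal one.\<close>

lemma rad_cluster:
  assumes g: "g \<in> pverts H" "H.d s g = j" and h: "h \<in> pverts H" "H.d s h = j"
    and gh: "(g, h) \<in> (above j)\<^sup>*"
  shows "rad g = rad h"
proof (cases "j = 0")
  case True
  then show ?thesis using g h H.d_zeroD H.root by metis
next
  case False
  define W where "W = {h \<in> pverts H. j \<le> H.d s h}"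
  have W: "pverts H - graph_ball (with_proj H) {s} (enat (j - 1)) = W"
    using H.gdist_eq[OF H.root] False by (auto simp: W_def graph_ball_def set_dist_def)
  have ends: "arcs_ends (with_proj H \<restriction> W) = above j"
    by (auto simp: arcs_ends_conv above_def W_def)
  have reach: "x \<rightarrow>\<^sup>*\<^bsub>with_proj H \<restriction> W\<^esub> y" if "(x, y) \<in> (above j)\<^sup>*" "x \<in> W" for x y
  proof -
    have "above j \<inter> W \<times> W = above j" by (auto simp: above_def W_def)
    then show ?thesis unfolding reachable_def ends using that by (simp add: rtrancl_on_iff)
  qed
  have "g \<in> W" "h \<in> W" using g h by (auto simp: W_def)
  then have cand: "cluster_candidate H s {g, h}"
    unfolding cluster_candidate_def
    using g h reach gh above_sym[OF gh] H.gdist_eq[OF H.root] False H.root W by auto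
  have "finite {S. cluster_candidate H s S}"
    by (rule finite_subset[of _ "Pow (pverts H)"])
      (use H.pair_finite_verts in \<open>auto simp: cluster_candidate_def\<close>)
  then obtain S where S: "{g, h} \<subseteq> S" "cluster_candidate H s S"
    "\<And>S'. cluster_candidate H s S' \<Longrightarrow> S \<subseteq> S' \<Longrightarrow> S' = S"
    using finite_has_maximal2[of "{S. cluster_candidate H s S}" "{g, h}"] cand by auto
  then have "cluster H s S" unfolding cluster_def by blast
  then have "height G H V s g = height G H V s h" using nice_cluster S(1) by blast
  moreover have "g \<noteq> s" "h \<noteq> s" using g h False H.root by auto
  ultimately show ?thesis by (simp add: rad_def)
qed

definition parent :: "'h \<Rightarrow> 'h" where "parent h = (SOME g. (g, h) \<in> H.up s)"

text \<open>Descends n layers from h through the chosen parents and adds up the lengths of the edges. By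
  \<open>grade_at_cluster\<close> the choice of the parents does not affect the result.\<close>

primrec grade_at :: "nat \<Rightarrow> 'h \<Rightarrow> nat" where
  "grade_at 0 h = 0"
| "grade_at (Suc n) h = grade_at n (parent h) + Suc (rad (parent h))"

definition grade :: "'h \<Rightarrow> nat" where "grade h = grade_at (H.d s h) h"

lemma parent_up: "h \<in> pverts H \<Longrightarrow> h \<noteq> s \<Longrightarrow> (parent h, h) \<in> H.up s"
  unfolding parent_def using H.ex_lower[OF H.root] by (rule someI_ex)

lemma above_parents:
  assumes "(g, h) \<in> (above (Suc j))\<^sup>*" "(p, g) \<in> H.up s" "(q, h) \<in> H.up s"
    "H.d s g = Suc j" "H.d s h = Suc j"
  shows "(p, q) \<in> (above j)\<^sup>*"
proof -
  have "above (Suc j) \<subseteq> above j" by (auto simp: above_def)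
  then have "(g, h) \<in> (above j)\<^sup>*" using assms(1) rtrancl_mono by blast
  moreover have "(p, g) \<in> above j" "(h, q) \<in> above j"
    using H.upD[OF assms(2)] H.upD[OF assms(3)] H.sym_arc assms(4,5) by (auto simp: above_def)
  ultimately show ?thesis by (meson converse_rtrancl_into_rtrancl rtrancl.rtrancl_into_rtrancl)
qed

text \<open>Parents of cluster mates are again cluster mates, by the walk through their children.\<close>

lemma grade_at_cluster:
  assumes "g \<in> pverts H" "H.d s g = j" "h \<in> pverts H" "H.d s h = j" "(g, h) \<in> (above j)\<^sup>*"
  shows "grade_at j g = grade_at j h"
  using assms
proof (induct j arbitrary: g h)
  case (Suc j)
  have "g \<noteq> s" "h \<noteq> s" using Suc H.root by auto
  then have up: "(parent g, g) \<in> H.up s" "(parent h, h) \<in> H.up s" using parent_up Suc by auto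
  note p = H.upD[OF up(1)] H.upD[OF up(2)]
  have ab: "(parent g, parent h) \<in> (above j)\<^sup>*" using above_parents Suc up by blast
  have l: "H.d s (parent g) = j" "H.d s (parent h) = j" using p Suc by auto
  show ?case using Suc(1)[OF _ l(1) _ l(2) ab] rad_cluster[OF _ l(1) _ l(2) ab] p by simp
qed simp

lemma grade_root: "grade s = 0" using H.root by (simp add: grade_def)

lemma grade_up:
  assumes gh: "(g, h) \<in> H.up s"
  shows "grade h = grade g + Suc (rad g)"
proof -
  note D = H.upD[OF gh]
  have "h \<noteq> s" using D H.root by auto
  then have up: "(parent h, h) \<in> H.up s" using parent_up D by blast
  note p = H.upD[OF up]
  have ab: "(g, parent h) \<in> (above (H.d s g))\<^sup>*"
    using D p by (intro above_parents[of h h _ g "parent h"] gh up) auto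
  have "H.d s (parent h) = H.d s g" using p D by simp
  then have "grade_at (H.d s g) (parent h) = grade g" "rad (parent h) = rad g"
    using grade_at_cluster[of g "H.d s g" "parent h"] rad_cluster[of g "H.d s g" "parent h"] ab D p
    by (auto simp: grade_def)
  then show ?thesis using D by (simp add: grade_def)
qed

text \<open>The sum of the grade of a part and the depth inside the part changes by at most one along
  every edge, and by exactly one along edges between parts. Hence it is the distance from the
  centre.\<close>

lemma potential_cross:
  assumes "(x, y) \<in> parcs G" "(node x, node y) \<in> H.up s"
  shows "grade (node y) + depth_in y = Suc (grade (node x) + depth_in x)" "depth_in y = 0"
  using depth_in_exit[OF assms] depth_in_bottom[OF bottom_of_arc[OF assms]] grade_up[OF assms(2)]
  by auto

lemma root_dist:
  assumes v: "v \<in> pverts G"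
  shows "G.d centre v = grade (node v) + depth_in v"
proof (rule antisym)
  define f where "f v = int (grade (node v) + depth_in v)" for v
  have "\<bar>f x - f y\<bar> \<le> 1" if xy: "(x, y) \<in> parcs G" for x y
    using arc_node[OF xy] potential_cross(1)[OF xy] potential_cross(1)[OF G.sym_arc[OF xy]]
      depth_in_arc[OF xy] depth_in_arc[OF G.sym_arc[OF xy]] by (fastforce simp: f_def)
  then have "\<bar>f centre - f v\<bar> \<le> int (G.d centre v)" using centre_vert v by (intro G.lipschitz)
  moreover have "node centre = s" using centre_props(1) node_eq H.root by blast
  then have "f centre = 0" using grade_root depth_in_bottom[of centre] by (simp add: f_def bottom_def)
  ultimately show "grade (node v) + depth_in v \<le> G.d centre v" by (simp add: f_def)
next
  show "G.d centre v \<le> grade (node v) + depth_in v"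
    using v
  proof (induct "H.d s (node v)" arbitrary: v rule: less_induct)
    case less
    obtain u where u: "u \<in> bottom (node v)" "(u, v) \<in> upper_arcs (node v) ^^ depth_in v"
      using depth_in_props(1)[OF less(2)] by blast
    have hv: "node v \<in> pverts H" using node_in less(2) by blast
    have uV: "u \<in> V (node v)" "u \<in> pverts G" using u(1) bottom_sub[OF hv] V_sub[OF hv] by auto
    have "(u, v) \<in> parcs G ^^ depth_in v"
      using u(2) relpow_subset[of "upper_arcs (node v)" "parcs G"] by (auto simp: upper_arcs_def)
    then have "G.d u v \<le> depth_in v" using G.d_le_relpow uV by blast
    moreover have "G.d centre v \<le> G.d centre u + G.d u v"
      using G.d_triangle centre_vert uV less(2) by blast
    moreover have "G.d centre u \<le> grade (node v)"
    proof (cases "node v = s")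
      case True
      then show ?thesis using u(1) centre_vert by (simp add: bottom_def)
    next
      case False
      then obtain x where x: "(u, x) \<in> parcs G" "(node x, node v) \<in> H.up s"
        using u(1) bottom_iff[OF hv] by blast
      have xv: "x \<in> pverts G" using G.in_arcsD2 x by blast
      have "G.d centre x \<le> grade (node x) + depth_in x" using less(1) H.upD(5)[OF x(2)] xv by simp
      moreover have "G.d centre u \<le> G.d centre x + 1"
        using G.d_arc_diff[OF G.sym_arc[OF x(1)] centre_vert] .
      ultimately show ?thesis using grade_up[OF x(2)] depth_in_props(2)[OF xv] by simp
    qed
    ultimately show ?case by simp
  qed
qed

lemma root_dist_bounds:
  assumes "v \<in> pverts G"
  shows "grade (node v) \<le> G.d centre v" "G.d centre v \<le> grade (node v) + rad (node v)"
    "G.d centre v \<le> grade (node v) + R"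
  using root_dist[OF assms] depth_in_props(2)[OF assms] rad_le[OF node_in(1)[OF assms]] by auto

lemma cross_up:
  assumes "(x, y) \<in> parcs G" "(node x, node y) \<in> H.up s"
  shows "(x, y) \<in> G.up centre" "G.d centre y = grade (node y)"
  using potential_cross[OF assms] root_dist[OF G.in_arcsD1[OF assms(1)]]
    root_dist[OF G.in_arcsD2[OF assms(1)]] assms(1) by (auto simp: G.up_def)

lemma up_node:
  assumes "(x, y) \<in> G.up centre"
  shows "node x = node y \<or> (node x, node y) \<in> H.up s"
proof -
  have xy: "(x, y) \<in> parcs G" "G.d centre y = Suc (G.d centre x)"
    using assms by (auto simp: G.up_def)
  have "(node y, node x) \<notin> H.up s"
    using cross_up(1)[OF G.sym_arc[OF xy(1)]] xy(2) by (auto simp: G.up_def)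
  then show ?thesis using arc_node[OF xy(1)] by blast
qed

lemma ups_node: "(x, y) \<in> (G.up centre)\<^sup>* \<Longrightarrow> (node x, node y) \<in> (H.up s)\<^sup>*"
  by (induct rule: rtrancl_induct) (auto dest: up_node intro: rtrancl_into_rtrancl)

end

section \<open>The quasi-isometry\<close>

locale coded_partition = rooted_partition G H s V R + S: coded_layered_graph H s code
  for G :: "'v pair_pre_digraph" and H :: "'h pair_pre_digraph" and s V R
    and code :: "'h \<times> 'h \<times> nat \<Rightarrow> nat"
begin

text \<open>The extra one is the edge of G that leads from the part of g into the part of h.\<close>

definition weight :: "'h \<Rightarrow> 'h \<Rightarrow> nat" where "weight g h = Suc (rad g)"

sublocale S: graded_subdivision H s code weight grade
proof
  show "S.positive_weight weight" by (auto simp: S.positive_weight_def weight_def)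
  show "grade s = 0" by (rule grade_root)
  show "grade h = grade g + weight g h" if "(g, h) \<in> H.up s" for g h
    using grade_up[OF that] by (simp add: weight_def)
qed

lemma weight_le: "(g, h) \<in> H.up s \<Longrightarrow> weight g h \<le> Suc R"
  using rad_le[of g] H.upD(2)[of g h] by (simp add: weight_def)

definition embed :: "'v \<Rightarrow> nat" where "embed x = S.node_pt (node x)"

lemma embed_in: "x \<in> pverts G \<Longrightarrow> embed x \<in> pverts S.K"
  using node_in(1) by (simp add: embed_def)

text \<open>Along an ascending path of G the parts form a vertical path of H, whose length in the
  subdivision is the difference of the grades, and grades differ from distances to the centre by at
  most R.\<close>

lemma embed_dist_le:
  assumes sip: "sipco (with_proj G) \<le> k" and xy: "x \<in> pverts G" "y \<in> pverts G"
  shows "S.K.d (embed x) (embed y) \<le> G.d x y + k * (R + R)"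
proof (rule G.sipco_distortion[OF sip centre_vert, where
      \<delta> = "\<lambda>x y. S.K.d (embed x) (embed y)"])
  show "S.K.d (embed x) (embed z) \<le> S.K.d (embed x) (embed y) + S.K.d (embed y) (embed z)"
    if "x \<in> pverts G" "y \<in> pverts G" "z \<in> pverts G" for x y z
    using S.K.d_triangle embed_in that by blast
  show "S.K.d (embed x) (embed y) = S.K.d (embed y) (embed x)"
    if "x \<in> pverts G" "y \<in> pverts G" for x y
    using S.K.d_sym embed_in that by blast
  show "S.K.d (embed x) (embed y) \<le> 1 + R"
    if xy: "(x, y) \<in> parcs G" for x y
  proof -
    have v: "x \<in> pverts G" "y \<in> pverts G" using xy G.in_arcsD1 G.in_arcsD2 by auto
    then have e: "embed x \<in> pverts S.K" "embed y \<in> pverts S.K" using embed_in by auto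
    have edge: "S.K.d (S.node_pt g) (S.node_pt h) \<le> Suc R" if "(g, h) \<in> H.up s" for g h
      using S.dist_edge_le[OF S.pos that] weight_le[OF that] by simp
    from arc_node[OF xy] show ?thesis
      using edge[of "node x" "node y"] edge[of "node y" "node x"] S.K.d_sym[OF e] S.K.d_self[OF e(1)]
      by (auto simp: embed_def)
  qed
  show "S.K.d (embed x) (embed y) \<le> G.d x y + R"
    if up: "(x, y) \<in> (G.up centre)\<^sup>*" and v: "x \<in> pverts G" "y \<in> pverts G" for x y
  proof -
    have "S.K.d (embed x) (embed y) + grade (node x) \<le> grade (node y)"
      unfolding embed_def by (rule S.chain_dist[OF ups_node[OF up] node_in(1)[OF v(1)]])
    then show ?thesis
      using G.up_dist[OF up v(1) centre_vert] root_dist_bounds(1)[OF v(2)]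
        root_dist_bounds(3)[OF v(1)] by simp
  qed
qed (use xy in auto)

text \<open>From the part of \<open>c j\<close> descend to the centre along a shortest path that first enters the part of
  \<open>c (j - 1)\<close>, and let \<open>c i\<close> be the lowest chain node whose part can be reached by continuing
  downwards. Either i = 0, or every continuation of the descent avoids the chain, so that \<open>c i\<close> is a
  free node. In both cases the descent to the part of \<open>c i\<close> is a shortest path of the expected
  length, and reaching its upper end inside the part of \<open>c j\<close> costs R. The induction restarts from
  \<open>c i\<close>, and the number of restarts is bounded by the number of free nodes.\<close>

lemma chain_part_dist:
  assumes sip: "sipco_class (subdivisions H) \<le> enat k"
    and chain: "\<And>i. i < m \<Longrightarrow> (c i, c (Suc i)) \<in> H.up s" and c0: "c 0 \<in> pverts H"
    and u: "u \<in> V (c 0)" and v: "v \<in> V (c m)"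
  shows "G.d u v + grade (c 0) \<le> grade (c m) + R * (k + 2)"
proof -
  define C where "C = c ` {..m}"
  define off where "off = H.up s \<inter> (- C) \<times> (- C)"
  define F where "F = {x \<in> C. \<exists>u. (u, x) \<in> H.up s \<and> u \<notin> C \<and> (s, u) \<in> off\<^sup>*}"
  have cardF: "card F \<le> k"
  proof (rule S.card_free_chain_nodes_le[OF sip chain c0 C_def])
    show "F \<subseteq> C" by (auto simp: F_def)
    show "\<exists>u. (u, x) \<in> H.up s \<and> u \<notin> C \<and> (s, u) \<in> (H.up s \<inter> (- C) \<times> (- C))\<^sup>*"
      if "x \<in> F" for x
      using that unfolding F_def off_def by blast
  qed
  have "finite F" by (simp add: F_def C_def)
  have cv: "c i \<in> pverts H" if "i \<le> m" for i
    using that chain H.upD(3) c0 by (cases i) (auto simp: Suc_le_eq)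
  have cL: "H.d s (c i) = H.d s (c 0) + i" if "i \<le> m" for i
    using that by (induct i) (simp_all add: H.upD(5)[OF chain])
  have c_inj: "i = j" if "c i = c j" "i \<le> m" "j \<le> m" for i j
  proof -
    have "H.d s (c i) = H.d s (c j)" using that(1) by simp
    then show ?thesis using cL[OF that(2)] cL[OF that(3)] by linarith
  qed
  have "G.d u v + grade (c 0) \<le> grade (c j) + R * (card (F \<inter> c ` {1..<j}) + 2)"
    if "j \<le> m" "v \<in> V (c j)" for j v
    using that
  proof (induct j arbitrary: v rule: less_induct)
    case (less j)
    show ?case
    proof (cases "j = 0")
      case True
      then show ?thesis using dist_in_part[OF c0 u, of v] less by simp
    next
      case False
      then have pj: "j - 1 < j" "j - 1 < m" "Suc (j - 1) = j" using less(2) by auto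
      have gh: "(c (j - 1), c j) \<in> H.up s" using chain[OF pj(2)] pj(3) by simp
      obtain y x where xy: "y \<in> V (c (j - 1))" "x \<in> V (c j)" "(y, x) \<in> parcs G"
        using arc_between H.upD(1)[OF gh] by blast
      have nodes: "node y = c (j - 1)" "node x = c j" using node_eq H.upD[OF gh] xy by auto
      have cross: "(y, x) \<in> G.up centre" "G.d centre x = grade (c j)"
        using cross_up[OF xy(3)] gh nodes by auto
      define I where "I = {i. i < j \<and> (\<exists>z\<in>V (c i). (z, x) \<in> (G.up centre)\<^sup>*)}"
      have "j - 1 \<in> I" using pj xy(1) cross(1) by (auto simp: I_def)
      define i where "i = (LEAST i. i \<in> I)"
      have iI: "i \<in> I" and least: "\<And>i'. i' \<in> I \<Longrightarrow> i \<le> i'"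
        using LeastI[of "\<lambda>i. i \<in> I", OF \<open>j - 1 \<in> I\<close>] Least_le[of "\<lambda>i. i \<in> I"]
        by (auto simp: i_def)
      then obtain z where i: "i < j" "z \<in> V (c i)" "(z, x) \<in> (G.up centre)\<^sup>*" by (auto simp: I_def)
      have ci: "c i \<in> pverts H" "i \<le> m" using cv i less(2) by auto
      have verts: "z \<in> pverts G" "x \<in> pverts G" "u \<in> pverts G" "v \<in> pverts G"
        using V_sub ci i(2) xy(2) H.upD(3)[OF gh] c0 u less(3) by blast+
      have nz: "node z = c i" using node_eq ci i(2) by blast
      have "G.d centre x = G.d centre z + G.d z x" using G.up_dist i(3) verts centre_vert by blast
      then have zx: "G.d z x + grade (c i) \<le> grade (c j)"
        using cross(2) root_dist_bounds(1)[OF verts(1)] nz by simp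
      have xv: "G.d x v \<le> R" using dist_in_part[OF H.upD(3)[OF gh] xy(2) less(3)] .
      have tri: "G.d u v \<le> G.d u z + (G.d z x + G.d x v)"
        using G.d_triangle[OF verts(3,1,4)] G.d_triangle[OF verts(1,2,4)] by simp
      show ?thesis
      proof (cases "i = 0")
        case True
        then have "G.d u z \<le> R" using dist_in_part[OF c0 u] i(2) by simp
        then have "G.d u v + grade (c 0) \<le> grade (c j) + R * 2"
          using tri zx xv True by simp
        then show ?thesis by (simp add: algebra_simps)
      next
        case False
        have sC: "s \<notin> C"
        proof
          assume "s \<in> C"
          then obtain l where l: "l \<le> m" "c l = s" by (auto simp: C_def)
          then have "H.d s (c l) = 0" using H.root by simp
          then have "l = 0" using cL[OF l(1)] by simp
          then have "centre \<in> V (c 0)" using l centre_props(1) by simp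
          moreover have "(centre, x) \<in> (G.up centre)\<^sup>*" by (rule G.up_from_root[OF centre_vert verts(2)])
          ultimately have "0 \<in> I" using i(1) by (auto simp: I_def)
          then show False using least False by blast
        qed
        have level: "H.d s (node a) \<le> H.d s (node b)" if "(a, b) \<in> (G.up centre)\<^sup>*" for a b
          using ups_node[OF that] by (induct rule: rtrancl_induct) (auto dest: H.upD(5))
        \<comment> \<open>By minimality of i, the part of the descent below z meets no chain node except c i.\<close>
        have hit: "node a = c i" if a: "(a, z) \<in> (G.up centre)\<^sup>*" "node a \<in> C" for a
        proof -
          obtain l where l: "l \<le> m" "node a = c l" using a(2) by (auto simp: C_def)
          have "H.d s (c l) \<le> H.d s (c i)" using level[OF a(1)] l(2) nz by simp
          then have "l \<le> i" using cL[OF l(1)] cL[OF ci(2)] by simp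
          moreover have "a \<in> V (c l)" using node_in(2)[of a] G.up_verts[OF a(1)] verts(1) l(2) by simp
          then have "l \<in> I" using \<open>l \<le> i\<close> i(1,3) a(1) by (auto simp: I_def intro: rtrancl_trans)
          then have "i \<le> l" by (rule least)
          ultimately show ?thesis using l(2) by simp
        qed
        have "(a, z) \<in> (G.up centre)\<^sup>* \<longrightarrow>
            (node a \<notin> C \<and> (s, node a) \<in> off\<^sup>*) \<or> (node a = c i \<and> c i \<in> F)"
          if "(centre, a) \<in> (G.up centre)\<^sup>*" for a
          using that
        proof (induct rule: rtrancl_induct)
          case base
          have "node centre = s" using node_eq[OF H.root centre_props(1)] .
          then show ?case using sC by simp
        next
          case (step a b)
          show ?case
          proof
            assume bz: "(b, z) \<in> (G.up centre)\<^sup>*"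
            then have az: "(a, z) \<in> (G.up centre)\<^sup>*" using step(2) by (rule converse_rtrancl_into_rtrancl[rotated])
            from up_node[OF step(2)]
            show "(node b \<notin> C \<and> (s, node b) \<in> off\<^sup>*) \<or> (node b = c i \<and> c i \<in> F)"
            proof
              assume "node a = node b"
              then show ?thesis using step(3) az by simp
            next
              assume ab: "(node a, node b) \<in> H.up s"
              have "node a \<noteq> c i" using level[OF bz] H.upD(5)[OF ab] nz by auto
              then have a: "node a \<notin> C" "(s, node a) \<in> off\<^sup>*" using step(3) az by auto
              show ?thesis
              proof (cases "node b \<in> C")
                case True
                then have "node b = c i" using hit bz by blast
                then show ?thesis using a ab True by (auto simp: F_def)
              next
                case False
                then have "(node a, node b) \<in> off" using a(1) ab by (simp add: off_def)
                then show ?thesis using a(2) False by (auto intro: rtrancl_into_rtrancl)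
              qed
            qed
          qed
        qed
        then have "c i \<in> F"
          using G.up_from_root[OF centre_vert verts(1)] nz ci(2) by (auto simp: C_def)
        moreover have "c i \<notin> c ` {1..<i}" using c_inj ci(2) by fastforce
        ultimately have "insert (c i) (F \<inter> c ` {1..<i}) \<subseteq> F \<inter> c ` {1..<j}"
          "card (insert (c i) (F \<inter> c ` {1..<i})) = Suc (card (F \<inter> c ` {1..<i}))"
          using False i(1) by auto
        then have "Suc (card (F \<inter> c ` {1..<i})) \<le> card (F \<inter> c ` {1..<j})"
          using \<open>finite F\<close> by (metis card_mono finite_Int)
        then have "R * (Suc (card (F \<inter> c ` {1..<i})) + 2) \<le> R * (card (F \<inter> c ` {1..<j}) + 2)"
          by (intro mult_left_mono) auto
        moreover have "G.d u z + grade (c 0) \<le> grade (c i) + R * (card (F \<inter> c ` {1..<i}) + 2)"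
          using less(1)[OF i(1) ci(2) i(2)] .
        ultimately show ?thesis using tri zx xv by simp
      qed
    qed
  qed
  then have "G.d u v + grade (c 0) \<le> grade (c m) + R * (card (F \<inter> c ` {1..<m}) + 2)" using v by simp
  moreover have "card (F \<inter> c ` {1..<m}) \<le> k"
    using card_mono[OF \<open>finite F\<close>, of "F \<inter> c ` {1..<m}"] cardF by simp
  then have "R * (card (F \<inter> c ` {1..<m}) + 2) \<le> R * (k + 2)" by (intro mult_left_mono) auto
  ultimately show ?thesis by linarith
qed

lemma up_part_dist:
  assumes sip: "sipco_class (subdivisions H) \<le> enat k"
    and gh: "(g, h) \<in> (H.up s)\<^sup>*" and g: "g \<in> pverts H" and uv: "u \<in> V g" "v \<in> V h"
  shows "G.d u v + grade g \<le> grade h + R * (k + 2)"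
proof -
  obtain m where "(g, h) \<in> H.up s ^^ m" using gh rtrancl_imp_relpow by blast
  then obtain c where c: "c 0 = g" "c m = h" "\<And>i. i < m \<Longrightarrow> (c i, c (Suc i)) \<in> H.up s"
    unfolding relpow_fun_conv by blast
  then show ?thesis using chain_part_dist[OF sip, of m c u v] g uv by simp
qed

definition rep :: "nat \<Rightarrow> 'v" where "rep z = (SOME v. v \<in> V (S.base z))"

lemma rep_in:
  assumes "z \<in> pverts S.K"
  shows "rep z \<in> V (S.base z)" "rep z \<in> pverts G"
proof -
  have "S.base z \<in> pverts H" using S.base_in assms by blast
  then have "\<exists>v. v \<in> V (S.base z)" using V_nonempty by blast
  then show "rep z \<in> V (S.base z)" unfolding rep_def by (rule someI_ex)
  then show "rep z \<in> pverts G" using V_sub \<open>S.base z \<in> pverts H\<close> by blast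
qed

text \<open>The second use of \<open>sipco_distortion\<close>, now in the subdivision. Comparable vertices project to the
  ends of a vertical path of H, where the chain bound applies.\<close>

lemma rep_dist_le:
  assumes sip: "sipco_class (subdivisions H) \<le> enat k"
    and v: "a \<in> pverts S.K" "b \<in> pverts S.K"
  shows "G.d (rep a) (rep b) \<le> S.K.d a b + k * (R * (k + 3) + 2 * R)"
proof (rule S.K.sipco_distortion[OF S.sipco_sub_le[OF sip S.pos], where r = "S.node_pt s" and
      \<delta> = "\<lambda>a b. G.d (rep a) (rep b)"])
  show "S.node_pt s \<in> pverts S.K" using H.root by simp
  show "G.d (rep a) (rep z) \<le> G.d (rep a) (rep b) + G.d (rep b) (rep z)"
    if "a \<in> pverts S.K" "b \<in> pverts S.K" "z \<in> pverts S.K" for a b z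
    using G.d_triangle rep_in(2) that by blast
  show "G.d (rep a) (rep b) = G.d (rep b) (rep a)"
    if "a \<in> pverts S.K" "b \<in> pverts S.K" for a b
    using G.d_sym rep_in(2) that by blast
  show "G.d (rep a) (rep b) \<le> 1 + 2 * R"
    if ab: "(a, b) \<in> parcs S.K" for a b
  proof -
    have v: "a \<in> pverts S.K" "b \<in> pverts S.K" using ab S.K.in_arcsD1 S.K.in_arcsD2 by auto
    note ra = rep_in[OF v(1)] and rb = rep_in[OF v(2)]
    have ba: "S.base a \<in> pverts H" "S.base b \<in> pverts H" using S.base_in v by auto
    from S.arc_base[OF ab] have "G.d (rep a) (rep b) \<le> Suc (2 * R)"
    proof
      assume "S.base a = S.base b"
      then show ?thesis using dist_in_part[OF ba(1) ra(1)] rb(1) by (metis le_SucI mult_2 trans_le_add1)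
    next
      assume "(S.base a, S.base b) \<in> parcs H"
      then obtain x y where xy: "x \<in> V (S.base a)" "y \<in> V (S.base b)" "(x, y) \<in> parcs G"
        using arc_between by blast
      then have "x \<in> pverts G" "y \<in> pverts G" using G.in_arcsD1 G.in_arcsD2 by auto
      then have "G.d (rep a) (rep b) \<le> G.d (rep a) x + (G.d x y + G.d y (rep b))"
        using G.d_triangle[of "rep a" x "rep b"] G.d_triangle[of x y "rep b"] ra rb by simp
      moreover have "G.d (rep a) x \<le> R" "G.d y (rep b) \<le> R" "G.d x y \<le> 1"
        using dist_in_part ba ra rb xy G.d_arc by blast+
      ultimately show ?thesis by simp
    qed
    then show ?thesis by simp
  qed
  show "G.d (rep a) (rep b) \<le> S.K.d a b + R * (k + 3)"
    if up: "(a, b) \<in> (S.K.up (S.node_pt s))\<^sup>*" and v: "a \<in> pverts S.K" "b \<in> pverts S.K" for a b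
  proof -
    have "G.d (rep a) (rep b) + grade (S.base a) \<le> grade (S.base b) + R * (k + 2)"
      using up_part_dist[OF sip S.ups_base[OF up]] S.base_in rep_in v by blast
    moreover have "S.elevation b = S.elevation a + S.K.d a b"
      using S.K.up_dist[OF up v(1)] S.root_dist v H.root by simp
    moreover have "grade (S.base b) \<le> S.elevation b" using S.dist_base[OF v(2)] by simp
    moreover have "S.elevation a \<le> grade (S.base a) + R" using S.ht_base_bound[OF v(1) weight_le] .
    ultimately have "G.d (rep a) (rep b) \<le> S.K.d a b + R + R * (k + 2)" by linarith
    then show ?thesis by (simp add: algebra_simps)
  qed
qed (use v in auto)

lemma dist_le_embed:
  assumes sip: "sipco_class (subdivisions H) \<le> enat k" and xy: "x \<in> pverts G" "y \<in> pverts G"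
  shows "G.d x y \<le> S.K.d (embed x) (embed y) + k * (R * (k + 3) + 2 * R) + 2 * R"
proof -
  have close: "rep (embed x) \<in> pverts G \<and> G.d x (rep (embed x)) \<le> R" if "x \<in> pverts G" for x
  proof -
    have "S.base (embed x) = node x" using node_in(1)[OF that] by (simp add: embed_def)
    then show ?thesis
      using rep_in[OF embed_in[OF that]] dist_in_part[OF node_in[OF that]] by simp
  qed
  have "G.d x y \<le> G.d x (rep (embed x)) + (G.d (rep (embed x)) (rep (embed y)) + G.d (rep (embed y)) y)"
    using G.d_triangle[of x "rep (embed x)" y] G.d_triangle[of "rep (embed x)" "rep (embed y)" y]
      close xy by fastforce
  moreover have "G.d (rep (embed y)) y \<le> R" using close[OF xy(2)] G.d_sym xy(2) by simp
  ultimately show ?thesis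
    using close[OF xy(1)] rep_dist_le[OF sip embed_in[OF xy(1)] embed_in[OF xy(2)]] by linarith
qed

lemma embed_dense:
  assumes z: "z \<in> pverts S.K"
  shows "\<exists>x\<in>pverts G. S.K.d z (embed x) \<le> R"
proof -
  have b: "S.base z \<in> pverts H" using S.base_in z by blast
  have "embed (rep z) = S.node_pt (S.base z)" using node_eq[OF b] rep_in[OF z] by (simp add: embed_def)
  moreover have "S.K.d (S.node_pt (S.base z)) z \<le> R"
    using S.dist_base[OF z] S.ht_base_bound[OF z weight_le] by simp
  ultimately have "S.K.d z (embed (rep z)) \<le> R" using S.K.d_sym z b by simp
  then show ?thesis using rep_in[OF z] by blast
qed

lemma embed_quasi_isometry:
  assumes "sipco (with_proj G) \<le> k" "sipco_class (subdivisions H) \<le> enat k" "1 \<le> k"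
  shows "quasi_isometry 1 (real (33 * R * k\<^sup>2)) (with_proj G) (with_proj S.K) embed"
proof -
  let ?A = "33 * R * k\<^sup>2"
  have k: "1 \<le> k * k" "k \<le> k * k" using assms(3) by auto
  have Rk: "R \<le> R * (k * k)" "R * k \<le> R * (k * k)" using k by (auto intro: mult_left_mono)
  have A: "?A = 33 * (R * (k * k))" by (simp add: power2_eq_square)
  have upper: "S.K.d (embed x) (embed y) \<le> G.d x y + ?A" if "x \<in> pverts G" "y \<in> pverts G" for x y
  proof -
    have "k * (R + R) = 2 * (R * k)" by (simp add: algebra_simps)
    also have "\<dots> \<le> ?A" unfolding A using Rk by linarith
    finally show ?thesis using embed_dist_le[OF assms(1) that] by linarith
  qed
  have lower: "G.d x y \<le> S.K.d (embed x) (embed y) + ?A" if "x \<in> pverts G" "y \<in> pverts G" for x y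
  proof -
    have "k * (R * (k + 3) + 2 * R) + 2 * R = R * (k * k) + 5 * (R * k) + 2 * R"
      by (simp add: algebra_simps)
    also have "\<dots> \<le> ?A" unfolding A using Rk by linarith
    finally show ?thesis using dist_le_embed[OF assms(2) that] by linarith
  qed
  have dense: "\<exists>x\<in>pverts G. S.K.d z (embed x) \<le> ?A" if "z \<in> pverts S.K" for z
  proof -
    have "R \<le> ?A" unfolding A using Rk by linarith
    then show ?thesis using embed_dense[OF that] by (meson order_trans)
  qed
  have coerce: "real a \<le> real b + real ?A" if "a \<le> b + ?A" for a b
    using that by (metis of_nat_add of_nat_le_iff)
  show ?thesis
    unfolding quasi_isometry_def using coerce[OF upper] coerce[OF lower] dense embed_in
    by (auto simp: Pi_iff diff_le_eq simp del: of_nat_mult of_nat_power)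
qed

end

theorem theorem5:
  fixes G :: "'v pair_pre_digraph" and H :: "'h pair_pre_digraph" and k R :: nat
  assumes "k \<ge> 1" and "R \<ge> 1"
    and "conn_graph G" and "conn_graph H"
    and "sipco (with_proj G) \<le> k"
    and "sipco_class (subdivisions H) \<le> enat k"
    and "\<exists>V s. graph_partition G H V \<and> honest G H V \<and> bounded_partition R G H V \<and>
           nicely_rooted R G H V s"
  shows "\<exists>F :: nat pair_pre_digraph. conn_graph F \<and> treewidth F \<le> treewidth H \<and>
           (\<exists>f. quasi_isometry 1 (real (33 * R * k\<^sup>2)) (with_proj G) (with_proj F) f)"
proof -
  obtain V s where V: "graph_partition G H V" "honest G H V" "bounded_partition R G H V"
    "nicely_rooted R G H V s"
    using assms(7) by blast
  interpret H: connected_graph H by unfold_locales fact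
  have s: "s \<in> pverts H" using V(4) by (simp add: nicely_rooted_def)
  have indep: "H.d s g \<noteq> H.d s h" if gh: "(g, h) \<in> parcs H" for g h
  proof
    assume "H.d s g = H.d s h"
    then have "g \<in> layer H s (H.d s g)" "h \<in> layer H s (H.d s g)"
      using H.gdist_eq[OF s] H.in_arcsD1[OF gh] H.in_arcsD2[OF gh] by (auto simp: layer_def)
    then show False using V(4) gh unfolding nicely_rooted_def by blast
  qed
  obtain e :: "'h \<Rightarrow> nat" where e: "inj_on e (pverts H)"
    using finite_imp_inj_to_nat_seg[OF H.pair_finite_verts] by blast
  define code where "code p = (case p of (g, h, i) \<Rightarrow> to_nat (e g, e h, i :: nat))" for p
  have code: "inj_on code (pverts H \<times> pverts H \<times> UNIV)"
    using e by (auto simp: inj_on_def code_def)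
  interpret coded_partition G H s V R code
    by unfold_locales (use assms(3) s indep V code in auto)
  show ?thesis
    using embed_quasi_isometry[OF assms(5,6,1)] S.treewidth_sub_le S.K.conn by blast
qed

end
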